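(* Consider sequences, indexed by $n$, of $p,k\in\mathbb{N}$ (with $1\le k\le p$), $\sigma>0$, $\tau>0$. For each $n$, let $(y_i,x_i)_{i=1}^n$ be i.i.d. from the model $y_i=x_i^T\beta+\sigma z_i$ with $x_i\sim\mathcal{N}(0,\frac1n I_p)$, $z_i\sim\mathcal{N}(0,1)$ independent of $x_i$, and $\beta\in\mathbb{R}^p$ fixed. Let $$\Theta(k,\tau)=\{\beta\in\mathbb{R}^p:\|\beta\|_0\le k,\ \|\beta\|_2^2\le k\tau^2\},\qquad R(\Theta(k,\tau),\sigma)=\inf_{\hat\beta}\sup_{\beta\in\Theta(k,\tau)}\mathbb{E}_\beta\|\hat\beta-\beta\|_2^2 .$$ Suppose $k/p\to0$, $k/n\to0$ and $\tau/\sigma\to0$. Then $$R(\Theta(k,\tau),\sigma)=k\tau^2\Big(1-\frac{k\tau^2}{p\sigma^2}(1+o(1))\Big).$$ In addition, the ridge estimator $\hat\beta^R(\lambda)\in\arg\min_{b\in\mathbb{R}^p}\sum_{i=1}^n(y_i-x_i^Tb)^2+\lambda\|b\|_2^2$ with tuning $\lambda=p\sigma^2/(k\tau^2)$ is asymptotically minimax optimal up to the second order, i.e. $$\sup_{\beta\in\Theta(k,\tau)}\mathbb{E}_\beta\|\hat\beta^R(\lambda)-\beta\|_2^2=k\tau^2\Big(1-\frac{k\tau^2}{p\sigma^2}(1+o(1))\Big).$$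
   Context: All asymptotics are as $n\to\infty$ and $p\to\infty$; the quantities $k,p,\sigma,\tau$ may all depend on $n$. $\|\beta\|_0$ is the number of nonzero entries of $\beta$, $\|\cdot\|_2$ is the Euclidean norm. $\mathbb{E}_\beta$ denotes expectation under the model with true parameter $\beta$. The infimum is over all estimators $\hat\beta$, i.e. measurable functions of the data $(y_i,x_i)_{i=1}^n$ with values in $\mathbb{R}^p$ (allowed to depend on $k,\tau,\sigma$). *)

theory Defs
  imports "HOL-Probability.Probability"
begin

text \<open>
  The dimension \<open>p\<close> depends on the sample size, so vectors in $R^p$ are functions
  \<open>nat \<Rightarrow> real\<close> that are extensional on \<open>{..<p}\<close>; a data set \<open>d\<close> of \<open>n\<close> observations
  is a function on \<open>{..<n}\<close> with \<open>d i = (y\<^sub>i, x\<^sub>i)\<close>.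
\<close>

abbreviation vec_space :: "nat \<Rightarrow> (nat \<Rightarrow> real) measure" where
  "vec_space p \<equiv> \<Pi>\<^sub>M j\<in>{..<p}. borel"

abbreviation vecs :: "nat \<Rightarrow> (nat \<Rightarrow> real) set" where
  "vecs p \<equiv> {..<p} \<rightarrow>\<^sub>E UNIV"

type_synonym dataset = "nat \<Rightarrow> real \<times> (nat \<Rightarrow> real)"

definition data_space :: "nat \<Rightarrow> nat \<Rightarrow> dataset measure" where
  "data_space n p = (\<Pi>\<^sub>M i\<in>{..<n}. borel \<Otimes>\<^sub>M vec_space p)"

definition l0norm :: "nat \<Rightarrow> (nat \<Rightarrow> real) \<Rightarrow> nat" where
  "l0norm p b = card {j \<in> {..<p}. b j \<noteq> 0}"

definition sqnorm :: "nat \<Rightarrow> (nat \<Rightarrow> real) \<Rightarrow> real" where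
  "sqnorm p b = (\<Sum>j<p. (b j)\<^sup>2)"

definition dotp :: "nat \<Rightarrow> (nat \<Rightarrow> real) \<Rightarrow> (nat \<Rightarrow> real) \<Rightarrow> real" where
  "dotp p x b = (\<Sum>j<p. x j * b j)"

definition Theta :: "nat \<Rightarrow> nat \<Rightarrow> real \<Rightarrow> (nat \<Rightarrow> real) set" where
  "Theta p k \<tau> = {\<beta> \<in> vecs p. l0norm p \<beta> \<le> k \<and> sqnorm p \<beta> \<le> real k * \<tau>\<^sup>2}"

text \<open>
  The law $N(0, I_p / n)$ is the product of \<open>p\<close> copies of $N(0, 1/n)$;
  \<open>normal_density\<close> is parametrised by the standard deviation.
\<close>

definition design_dist :: "nat \<Rightarrow> nat \<Rightarrow> (nat \<Rightarrow> real) measure" where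
  "design_dist n p =
     (\<Pi>\<^sub>M j\<in>{..<p}. density lborel (\<lambda>t. ennreal (normal_density 0 (1 / sqrt (real n)) t)))"

definition noise_dist :: "real measure" where
  "noise_dist = density lborel (\<lambda>t. ennreal (std_normal_density t))"

text \<open>The joint law of one observation $(x^T \beta + \sigma z, x)$.\<close>

definition obs_dist ::
    "nat \<Rightarrow> nat \<Rightarrow> real \<Rightarrow> (nat \<Rightarrow> real) \<Rightarrow> (real \<times> (nat \<Rightarrow> real)) measure" where
  "obs_dist n p \<sigma> \<beta> =
     distr (design_dist n p \<Otimes>\<^sub>M noise_dist) (borel \<Otimes>\<^sub>M vec_space p)
       (\<lambda>(x, z). (dotp p x \<beta> + \<sigma> * z, x))"

definition data_dist :: "nat \<Rightarrow> nat \<Rightarrow> real \<Rightarrow> (nat \<Rightarrow> real) \<Rightarrow> dataset measure" where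
  "data_dist n p \<sigma> \<beta> = (\<Pi>\<^sub>M i\<in>{..<n}. obs_dist n p \<sigma> \<beta>)"

definition estimators :: "nat \<Rightarrow> nat \<Rightarrow> (dataset \<Rightarrow> nat \<Rightarrow> real) set" where
  "estimators n p = data_space n p \<rightarrow>\<^sub>M vec_space p"

text \<open>Risks are extended nonnegative, as an arbitrary estimator may have infinite risk.\<close>

definition risk ::
    "nat \<Rightarrow> nat \<Rightarrow> real \<Rightarrow> (dataset \<Rightarrow> nat \<Rightarrow> real) \<Rightarrow> (nat \<Rightarrow> real) \<Rightarrow> ennreal" where
  "risk n p \<sigma> h \<beta> =
     (\<integral>\<^sup>+ d. ennreal (sqnorm p (\<lambda>j. h d j - \<beta> j)) \<partial>data_dist n p \<sigma> \<beta>)"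

definition worst_case_risk ::
    "nat \<Rightarrow> nat \<Rightarrow> nat \<Rightarrow> real \<Rightarrow> real \<Rightarrow> (dataset \<Rightarrow> nat \<Rightarrow> real) \<Rightarrow> ennreal" where
  "worst_case_risk n p k \<tau> \<sigma> h = (SUP \<beta>\<in>Theta p k \<tau>. risk n p \<sigma> h \<beta>)"

definition minimax_risk :: "nat \<Rightarrow> nat \<Rightarrow> nat \<Rightarrow> real \<Rightarrow> real \<Rightarrow> ennreal" where
  "minimax_risk n p k \<tau> \<sigma> = (INF h\<in>estimators n p. worst_case_risk n p k \<tau> \<sigma> h)"

definition ridge_objective ::
    "nat \<Rightarrow> nat \<Rightarrow> real \<Rightarrow> dataset \<Rightarrow> (nat \<Rightarrow> real) \<Rightarrow> real" where
  "ridge_objective n p l d b =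
     (\<Sum>i<n. (fst (d i) - dotp p (snd (d i)) b)\<^sup>2) + l * sqnorm p b"

text \<open>The measurable selections from the set of minimisers of the ridge objective.\<close>

definition ridge_estimators :: "nat \<Rightarrow> nat \<Rightarrow> real \<Rightarrow> (dataset \<Rightarrow> nat \<Rightarrow> real) set" where
  "ridge_estimators n p l =
     {h \<in> estimators n p. \<forall>d\<in>space (data_space n p).
        is_arg_min (ridge_objective n p l d) (\<lambda>b. b \<in> vecs p) (h d)}"

end

theory Submission imports Defs begin

text \<open>
  Write $M = k \tau^2$, $\lambda = p \sigma^2 / M$ and $r = \tau^2/\sigma^2$. As
  $1/\lambda = (k/p) r$ and $(p/n)/\lambda = (k/n) r$ both tend to 0, it suffices to bound the ridge
  risk above by $M (1 - 1/\lambda + (3 + 9 p/n)/\lambda^2)$ and the minimax risk below by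
  $M (1 - (1 + o(1))/\lambda)$.

  Upper bound: with $G = X^T X$, the squared bias is at most
  $|\beta|^2 - 2 \beta^T G \beta/\lambda + 3 |G\beta|^2/\lambda^2$ and the variance at most
  $\sigma^2 |X^T z|^2/\lambda^2$; only the expectations of $G$ and $G^2$ enter, and
  $p \sigma^2 = \lambda M$ combines the two terms.

  Lower bound: split the coordinates into $k$ blocks of size $m = p$ div $k$ and put a spike
  $\pm\tau$ at a uniform position of each block. With the other blocks revealed, the Bayes risk in
  one block is $\tau^2$ minus the second moment of the posterior mean. Under the law without the
  spike, the normalising constant of the posterior is an average over the block that is at least
  the mean of $\exp(-r |X_j|^2/2)$, whose inverse is controlled by the harmonic-arithmetic mean
  inequality. What remains are Gaussian exponential moments, giving $(\tau^2/m) r (1 + o(1))$ per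
  block and hence $(M/\lambda)(1 + o(1))$ in total.
\<close>

section \<open>Ridge regression\<close>

text \<open>Both bounds have to be exact at relative order \<open>1/\<lambda>\<close>, so nothing of
  that size may be lost. For a ridge parameter \<open>l\<close> the leading terms are
  \<open>- 2 M / l\<close> from the bias and \<open>p \<sigma>\<^sup>2 / l\<^sup>2\<close> from the
  variance; this quadratic in \<open>1 / l\<close> is smallest at \<open>l = \<lambda>\<close>,
  which is the origin of the tuning. The ratio \<open>p / n\<close> is not controlled, so the Gram
  matrix is never compared with the identity: only means of quadratic expressions in it are used. In
  the prior, one spike per block gives membership in \<open>Theta\<close> without truncation. The
  random signs are essential: with a constant sign and a random position the posterior mean is about
  \<open>\<tau> / m\<close> everywhere, and its second moment is of order
  \<open>\<tau>\<^sup>2 / m\<close> instead of \<open>r \<tau>\<^sup>2 / m\<close>. The posterior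
  normaliser is a random denominator; replacing its inverse by an average of exponentials makes
  every remaining integral Gaussian and explicit. The resulting constant
  \<open>1 / sqrt (1 - 3 r) - 1 + r / 2\<close> is \<open>2 r\<close> to first order, which gives
  exactly the required leading coefficient.\<close>

lemma dotp_add: "dotp p x (\<lambda>j. u j + v j) = dotp p x u + dotp p x v"
  by (simp add: dotp_def algebra_simps sum.distrib)

lemma dotp_diff: "dotp p x (\<lambda>j. u j - v j) = dotp p x u - dotp p x v"
  by (simp add: dotp_def algebra_simps sum_subtractf)

lemma dotp_scale: "dotp p x (\<lambda>j. c * u j) = c * dotp p x u"
  by (simp add: dotp_def sum_distrib_left algebra_simps)

lemma dotp_commute: "dotp p x u = dotp p u x"
  by (simp add: dotp_def mult.commute)

lemma dotp_cong: "(\<And>j. j < p \<Longrightarrow> u j = v j) \<Longrightarrow> dotp p x u = dotp p x v"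
  by (simp add: dotp_def)

lemma dotp_self: "dotp p u u = sqnorm p u"
  by (simp add: dotp_def sqnorm_def power2_eq_square)

lemma sqnorm_cong: "(\<And>j. j < p \<Longrightarrow> u j = v j) \<Longrightarrow> sqnorm p u = sqnorm p v"
  by (simp add: sqnorm_def)

lemma sqnorm_nonneg [simp]: "0 \<le> sqnorm p u"
  by (simp add: sqnorm_def sum_nonneg)

lemma sqnorm_scale: "sqnorm p (\<lambda>j. c * u j) = c\<^sup>2 * sqnorm p u"
  by (simp add: sqnorm_def sum_distrib_left power_mult_distrib)

lemma sqnorm_add: "sqnorm p (\<lambda>j. u j + v j) = sqnorm p u + 2 * dotp p u v + sqnorm p v"
  by (simp add: sqnorm_def dotp_def power2_sum sum.distrib sum_distrib_left algebra_simps)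

lemma sqnorm_diff: "sqnorm p (\<lambda>j. u j - v j) = sqnorm p u - 2 * dotp p u v + sqnorm p v"
  by (simp add: sqnorm_def dotp_def power2_diff sum.distrib sum_subtractf sum_distrib_left algebra_simps)

lemma sqnorm_eq_0D: "sqnorm p u = 0 \<Longrightarrow> j < p \<Longrightarrow> u j = 0"
  by (simp add: sqnorm_def sum_nonneg_eq_0_iff)

text \<open>The vector \<open>X\<^sup>T X v\<close> for rows \<open>X i\<close>. Plain functions
  stand in for a matrix type because \<open>p\<close> is a term that varies with
  \<open>n\<close>.\<close>

definition gramv :: "nat \<Rightarrow> nat \<Rightarrow> (nat \<Rightarrow> nat \<Rightarrow> real) \<Rightarrow> (nat \<Rightarrow> real) \<Rightarrow> nat \<Rightarrow> real" where
  "gramv n p X v j = (\<Sum>i<n. X i j * dotp p (X i) v)"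

lemma gramv_add: "gramv n p X (\<lambda>j. u j + v j) j = gramv n p X u j + gramv n p X v j"
  by (simp add: gramv_def dotp_add algebra_simps sum.distrib)

lemma gramv_diff: "gramv n p X (\<lambda>j. u j - v j) j = gramv n p X u j - gramv n p X v j"
  by (simp add: gramv_def dotp_diff algebra_simps sum_subtractf)

lemma gramv_scale: "gramv n p X (\<lambda>j. c * u j) j = c * gramv n p X u j"
  by (simp add: gramv_def dotp_scale sum_distrib_left algebra_simps)

text \<open>Exchanging the sums gives the inner product of \<open>X u\<close> and
  \<open>X v\<close>, hence symmetry and positivity of the Gram form, the properties behind the
  perturbation bounds below.\<close>

lemma dotp_gramv: "dotp p u (gramv n p X v) = (\<Sum>i<n. dotp p (X i) u * dotp p (X i) v)"
proof -
  have "dotp p u (gramv n p X v) = (\<Sum>j<p. \<Sum>i<n. u j * (X i j * dotp p (X i) v))"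
    by (simp add: dotp_def[of p u] gramv_def sum_distrib_left)
  also have "\<dots> = (\<Sum>i<n. \<Sum>j<p. u j * (X i j * dotp p (X i) v))"
    by (rule sum.swap)
  also have "\<dots> = (\<Sum>i<n. dotp p (X i) u * dotp p (X i) v)"
    by (intro sum.cong refl) (simp add: dotp_commute[of p _ u] dotp_def[of p u] sum_distrib_right mult.assoc)
  finally show ?thesis .
qed

lemma dotp_gramv_commute: "dotp p u (gramv n p X v) = dotp p v (gramv n p X u)"
  by (simp add: dotp_gramv mult.commute)

lemma dotp_gramv_nonneg: "0 \<le> dotp p u (gramv n p X u)"
  by (simp add: dotp_gramv sum_nonneg)

text \<open>The inverse of \<open>X\<^sup>T X + l\<close> has norm at most \<open>1 / l\<close>; no
  inverse is formed, since in the expanded square the Gram term and the cross term are both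
  nonnegative. With \<open>w = 0\<close> this yields uniqueness of the ridge solution.\<close>

lemma sqnorm_regularised_le:
  assumes l: "l > 0" and eq: "\<And>j. j < p \<Longrightarrow> gramv n p X v j + l * v j = w j"
  shows "l\<^sup>2 * sqnorm p v \<le> sqnorm p w"
proof -
  have "sqnorm p w = sqnorm p (\<lambda>j. gramv n p X v j + l * v j)"
    by (rule sqnorm_cong) (simp add: eq)
  also have "\<dots> = sqnorm p (gramv n p X v) + 2 * l * dotp p v (gramv n p X v) + l\<^sup>2 * sqnorm p v"
    by (simp add: sqnorm_add dotp_scale sqnorm_scale dotp_commute)
  finally show ?thesis
    using l dotp_gramv_nonneg[of p v n X] by simp
qed

text \<open>The inverse of \<open>X\<^sup>T X + l\<close> is built one observation at a time by the Sherman--Morrison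
  formula; this makes the ridge estimator visibly measurable in the data.\<close>

fun ridge_solve :: "real \<Rightarrow> nat \<Rightarrow> (nat \<Rightarrow> nat \<Rightarrow> real) \<Rightarrow> nat \<Rightarrow> (nat \<Rightarrow> real) \<Rightarrow> nat \<Rightarrow> real" where
  "ridge_solve l p X 0 w = (\<lambda>j. w j / l)"
| "ridge_solve l p X (Suc i) w = (\<lambda>j. ridge_solve l p X i w j
     - dotp p (X i) (ridge_solve l p X i w) / (1 + dotp p (X i) (ridge_solve l p X i (X i)))
       * ridge_solve l p X i (X i) j)"

text \<open>The induction keeps the right-hand side \<open>w\<close> arbitrary, because the
  recursion solves both for \<open>w\<close> and for the new row \<open>X i\<close>.\<close>

lemma ridge_solve_correct:
  assumes l: "l > 0"
  shows "gramv i p X (ridge_solve l p X i w) j + l * ridge_solve l p X i w j = w j"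
proof (induction i arbitrary: w j)
  case 0
  then show ?case using l by (simp add: gramv_def)
next
  case (Suc i)
  define s where "s = ridge_solve l p X i w"
  define t where "t = ridge_solve l p X i (X i)"
  define D where "D = 1 + dotp p (X i) t"
  define c where "c = dotp p (X i) s / D"
  have s: "gramv i p X s j + l * s j = w j" for j
    using Suc.IH[of w] by (simp add: s_def)
  have t: "gramv i p X t j + l * t j = X i j" for j
    using Suc.IH[of "X i"] by (simp add: t_def)
  \<comment> \<open>Pairing the equation for \<open>t\<close> with \<open>t\<close> itself keeps the
    Sherman--Morrison denominator positive for arbitrary rows.\<close>
  have "dotp p (X i) t = dotp p t (\<lambda>j. gramv i p X t j + l * t j)"
    by (simp add: t dotp_commute)
  also have "\<dots> \<ge> 0"
    using l by (simp add: dotp_add dotp_scale dotp_self dotp_gramv_nonneg)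
  finally have "D > 0" by (simp add: D_def)
  \<comment> \<open>\<open>c\<close> is the inner product of \<open>X i\<close> with the new
    solution \<open>s - c t\<close>. The rank-one term therefore contributes exactly
    \<open>c * X i\<close>, which cancels the \<open>- c * X i\<close> left by the old
    system.\<close>
  then have c: "dotp p (X i) s - c * dotp p (X i) t = c"
    by (simp add: c_def D_def field_simps)
  have sol: "ridge_solve l p X (Suc i) w = (\<lambda>j. s j - c * t j)"
    by (simp add: s_def t_def c_def D_def)
  have "gramv (Suc i) p X (\<lambda>j. s j - c * t j) j + l * (s j - c * t j)
     = (gramv i p X s j + l * s j) - c * (gramv i p X t j + l * t j)
       + X i j * (dotp p (X i) s - c * dotp p (X i) t)"
    by (simp add: gramv_def dotp_diff dotp_scale algebra_simps sum.distrib sum_subtractf sum_distrib_left)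
  also have "\<dots> = w j"
    by (simp only: s t c) (simp add: algebra_simps)
  finally show ?case by (simp only: sol)
qed

lemma measurable_ridge_solve:
  assumes [measurable]: "\<And>i j. i < n \<Longrightarrow> j < p \<Longrightarrow> (\<lambda>d. X d i j) \<in> borel_measurable M"
    and "\<And>j. j < p \<Longrightarrow> (\<lambda>d. w d j) \<in> borel_measurable M"
    and "i \<le> n" "j < p"
  shows "(\<lambda>d. ridge_solve l p (X d) i (w d) j) \<in> borel_measurable M"
  using assms(2-)
proof (induction i arbitrary: w j)
  case 0
  then show ?case by (simp add: borel_measurable_divide)
next
  case (Suc i)
  have [measurable]: "(\<lambda>d. ridge_solve l p (X d) i (w d) j) \<in> borel_measurable M"
    "(\<lambda>d. ridge_solve l p (X d) i (X d i) j) \<in> borel_measurable M"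
    if "j < p" for j
    using Suc that by (auto intro!: Suc.IH)
  have [measurable]: "(\<lambda>d. X d i j) \<in> borel_measurable M" if "j < p" for j
    using Suc that by simp
  show ?case
    using Suc.prems unfolding ridge_solve.simps dotp_def by measurable
qed

section \<open>Normal equations of the ridge problem\<close>

lemma ridge_objective_shift:
  "ridge_objective n p l d (\<lambda>j. b j + v j) = ridge_objective n p l d b
     - 2 * dotp p v (\<lambda>j. (\<Sum>i<n. snd (d i) j * fst (d i)) - (gramv n p (\<lambda>i. snd (d i)) b j + l * b j))
     + ((\<Sum>i<n. (dotp p (snd (d i)) v)\<^sup>2) + l * sqnorm p v)"
proof -
  have *: "dotp p v (\<lambda>j. \<Sum>i<n. snd (d i) j * fst (d i)) = (\<Sum>i<n. fst (d i) * dotp p (snd (d i)) v)"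
    unfolding dotp_def sum_distrib_left
    by (subst sum.swap) (simp add: mult_ac)
  show ?thesis
    unfolding ridge_objective_def dotp_diff dotp_add dotp_scale * dotp_gramv sqnorm_add
    by (simp add: power2_eq_square algebra_simps sum.distrib sum_subtractf sum_distrib_left dotp_commute)
qed

text \<open>The objective is quadratic: its exact expansion at \<open>b\<close> has linear part
  \<open>-2 * dotp p v g\<close>, where \<open>g\<close> is minus half the gradient, and a
  nonnegative second-order part \<open>Q\<close>. So \<open>b\<close> is minimal exactly when
  \<open>g\<close> vanishes on the first \<open>p\<close> coordinates.\<close>

lemma ridge_argmin_iff:
  assumes l: "l > 0"
  shows "is_arg_min (ridge_objective n p l d) (\<lambda>b. b \<in> vecs p) b \<longleftrightarrow>
    b \<in> vecs p \<and> (\<forall>j<p. gramv n p (\<lambda>i. snd (d i)) b j + l * b j = (\<Sum>i<n. snd (d i) j * fst (d i)))"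
proof -
  define g where "g j = (\<Sum>i<n. snd (d i) j * fst (d i)) - (gramv n p (\<lambda>i. snd (d i)) b j + l * b j)" for j
  define Q where "Q v = (\<Sum>i<n. (dotp p (snd (d i)) v)\<^sup>2) + l * sqnorm p v" for v
  have Q0: "Q v \<ge> 0" for v
    using l by (simp add: Q_def sum_nonneg)
  have Qs: "Q (\<lambda>j. c * v j) = c\<^sup>2 * Q v" for c v
    by (simp add: Q_def dotp_scale sqnorm_scale power_mult_distrib sum_distrib_left algebra_simps)
  have sh: "ridge_objective n p l d (\<lambda>j. b j + v j) = ridge_objective n p l d b - 2 * dotp p v g + Q v" for v
    unfolding ridge_objective_shift g_def Q_def by simp
  have ext: "ridge_objective n p l d u = ridge_objective n p l d v" if "\<And>j. j < p \<Longrightarrow> u j = v j" for u v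
    using that by (simp add: ridge_objective_def dotp_cong[of p u v] sqnorm_cong[of p u v])
  show ?thesis
  proof (intro iffI conjI allI impI)
    assume am: "is_arg_min (ridge_objective n p l d) (\<lambda>b. b \<in> vecs p) b"
    then show "b \<in> vecs p"
      by (simp add: is_arg_min_def)
    fix j assume j: "j < p"
    \<comment> \<open>The minimiser is compared with a move along \<open>g\<close>, the direction of
      steepest descent, by a free amount \<open>c\<close>. Restriction makes the competitor
      extensional without changing the objective.\<close>
    have le: "2 * c * sqnorm p g \<le> c\<^sup>2 * Q g" for c
    proof -
      have "restrict (\<lambda>j. b j + c * g j) {..<p} \<in> vecs p" by simp
      with am have "\<not> ridge_objective n p l d (restrict (\<lambda>j. b j + c * g j) {..<p}) < ridge_objective n p l d b"
        unfolding is_arg_min_def by blast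
      also have "ridge_objective n p l d (restrict (\<lambda>j. b j + c * g j) {..<p})
        = ridge_objective n p l d (\<lambda>j. b j + c * g j)"
        by (rule ext) simp
      finally show ?thesis
        by (simp add: sh Qs dotp_commute[of p "\<lambda>j. c * g j"] dotp_scale dotp_self)
    qed
    have "sqnorm p g = 0"
    proof (rule ccontr)
      assume "sqnorm p g \<noteq> 0"
      then have pos: "sqnorm p g > 0" using sqnorm_nonneg[of p g] by linarith
      \<comment> \<open>A step so short that the quadratic cost stays below the linear gain; the
        \<open>+ 1\<close> covers \<open>Q g = 0\<close>.\<close>
      define c where "c = sqnorm p g / (Q g + 1)"
      have c: "c > 0" using pos Q0[of g] by (simp add: c_def)
      have "2 * c * sqnorm p g \<le> c * (c * Q g)"
        using le[of c] by (simp add: power2_eq_square mult_ac)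
      then have "2 * sqnorm p g \<le> c * Q g" using c by simp
      also have "c * Q g \<le> sqnorm p g"
        using pos Q0[of g] by (simp add: c_def field_simps)
      finally show False using pos by simp
    qed
    then show "gramv n p (\<lambda>i. snd (d i)) b j + l * b j = (\<Sum>i<n. snd (d i) j * fst (d i))"
      using sqnorm_eq_0D[of p g j] j by (simp add: g_def)
  next
    assume asm: "b \<in> vecs p \<and> (\<forall>j<p. gramv n p (\<lambda>i. snd (d i)) b j + l * b j = (\<Sum>i<n. snd (d i) j * fst (d i)))"
    have "ridge_objective n p l d b \<le> ridge_objective n p l d y" for y
    proof -
      have "dotp p v g = 0" for v
        using asm by (simp add: dotp_def g_def)
      then show ?thesis
        using sh[of "\<lambda>j. y j - b j"] Q0[of "\<lambda>j. y j - b j"] by simp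
    qed
    then show "is_arg_min (ridge_objective n p l d) (\<lambda>b. b \<in> vecs p) b"
      using asm by (auto simp: is_arg_min_def not_less)
  qed
qed

lemma measurable_data_components [measurable (raw)]:
  assumes "i < n"
  shows "(\<lambda>d. fst (d i)) \<in> borel_measurable (data_space n p)"
    and "j < p \<Longrightarrow> (\<lambda>d. snd (d i) j) \<in> borel_measurable (data_space n p)"
  using assms measurable_component_singleton[of i "{..<n}" "\<lambda>_. borel \<Otimes>\<^sub>M vec_space p"]
    measurable_component_singleton[of j "{..<p}" "\<lambda>_. borel"]
  by (auto simp: data_space_def)

lemma ridge_estimators_iff:
  assumes "l > 0"
  shows "h \<in> ridge_estimators n p l \<longleftrightarrow> h \<in> estimators n p \<and>
    (\<forall>d\<in>space (data_space n p). \<forall>j<p.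
       gramv n p (\<lambda>i. snd (d i)) (h d) j + l * h d j = (\<Sum>i<n. snd (d i) j * fst (d i)))"
proof -
  have "h d \<in> vecs p" if "h \<in> estimators n p" "d \<in> space (data_space n p)" for d
    using measurable_space[of h "data_space n p" "vec_space p" d] that
    by (simp add: estimators_def space_PiM)
  then show ?thesis
    unfolding ridge_estimators_def ridge_argmin_iff[OF assms] by blast
qed

lemma ridge_estimators_nonempty:
  assumes l: "l > 0"
  shows "ridge_estimators n p l \<noteq> {}"
proof -
  define h where "h d = (\<lambda>j\<in>{..<p}. ridge_solve l p (\<lambda>i. snd (d i)) n (\<lambda>j. \<Sum>i<n. snd (d i) j * fst (d i)) j)"
    for d :: dataset
  have "h \<in> estimators n p"
    unfolding estimators_def h_def
    by (intro CollectI measurable_restrict measurable_ridge_solve[where n = n]) auto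
  moreover have "gramv n p X (h d) j + l * h d j = (\<Sum>i<n. snd (d i) j * fst (d i))"
    if "j < p" "X = (\<lambda>i. snd (d i))" for d j X
  proof -
    have "gramv n p X (h d) j = gramv n p X (ridge_solve l p X n (\<lambda>j. \<Sum>i<n. snd (d i) j * fst (d i))) j"
      unfolding gramv_def using that by (auto intro!: sum.cong dotp_cong simp: h_def)
    moreover have "h d j = ridge_solve l p X n (\<lambda>j. \<Sum>i<n. snd (d i) j * fst (d i)) j"
      using that by (simp add: h_def)
    ultimately show ?thesis
      using ridge_solve_correct[OF l, of n p X "\<lambda>j. \<Sum>i<n. snd (d i) j * fst (d i)" j] by simp
  qed
  ultimately have "h \<in> ridge_estimators n p l"
    by (simp add: ridge_estimators_iff[OF l])
  then show ?thesis by blast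
qed

lemma ridge_estimators_unique:
  assumes l: "l > 0" and h: "h \<in> ridge_estimators n p l" "h' \<in> ridge_estimators n p l"
    and d: "d \<in> space (data_space n p)" and j: "j < p"
  shows "h d j = h' d j"
proof -
  have "l\<^sup>2 * sqnorm p (\<lambda>j. h d j - h' d j) \<le> sqnorm p (\<lambda>j. 0)"
    using h d unfolding ridge_estimators_iff[OF l]
    by (intro sqnorm_regularised_le[OF l, of p n "\<lambda>i. snd (d i)"]) (simp add: gramv_diff algebra_simps)
  then have "sqnorm p (\<lambda>j. h d j - h' d j) \<le> 0"
    using l by (simp add: sqnorm_def mult_le_0_iff)
  then have "sqnorm p (\<lambda>j. h d j - h' d j) = 0"
    using sqnorm_nonneg[of p "\<lambda>j. h d j - h' d j"] by linarith
  from sqnorm_eq_0D[OF this j] show ?thesis by simp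
qed

text \<open>Here \<open>w\<close> is the bias vector and \<open>c = b - w\<close> solves
  \<open>G c + l c = G b\<close>, so \<open>c\<close> is \<open>G b / l\<close> up to second order.
  Of the factor 3, two units pay for this replacement in \<open>2 * dotp p b c\<close> and one
  bounds \<open>sqnorm p c\<close>. No bound on \<open>G\<close> enters, so \<open>p\<close> may be
  far larger than \<open>n\<close>.\<close>

lemma ridge_bias_bound:
  assumes l: "l > 0" and eq: "\<And>j. j < p \<Longrightarrow> gramv n p X w j + l * w j = l * b j"
  shows "sqnorm p w \<le> sqnorm p b - 2 * dotp p b (gramv n p X b) / l + 3 * sqnorm p (gramv n p X b) / l\<^sup>2"
proof -
  define G where "G = gramv n p X"
  define c where "c j = b j - w j" for j
  have c_eq: "G c j + l * c j = G b j" if "j < p" for j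
    using eq[OF that] by (simp add: c_def[abs_def] G_def gramv_diff algebra_simps)
  have c_le: "l\<^sup>2 * sqnorm p c \<le> sqnorm p (G b)"
    using l c_eq unfolding G_def by (rule sqnorm_regularised_le)
  have "sqnorm p (\<lambda>j. b j - c j) = sqnorm p b - 2 * dotp p b c + sqnorm p c"
    by (rule sqnorm_diff)
  moreover have "(\<lambda>j. b j - c j) = w" by (simp add: c_def)
  ultimately have w: "sqnorm p w = sqnorm p b - 2 * dotp p b c + sqnorm p c" by simp
  \<comment> \<open>Testing the equation for \<open>c\<close> against \<open>b\<close> and moving
    \<open>G\<close> across by symmetry isolates \<open>dotp p b c\<close>; the leftover
    \<open>dotp p c (G b)\<close> is of second order.\<close>
  have "dotp p b (\<lambda>j. G c j + l * c j) = dotp p b (G b)"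
    using c_eq by (rule dotp_cong)
  then have "l * dotp p b c = dotp p b (G b) - dotp p c (G b)"
    by (simp add: dotp_add dotp_scale G_def dotp_gramv_commute[of p b n X c])
  moreover have "2 * l * dotp p c (G b) \<le> sqnorm p (G b) + l\<^sup>2 * sqnorm p c"
    using sqnorm_nonneg[of p "\<lambda>j. G b j - l * c j"]
    by (simp add: sqnorm_diff dotp_scale sqnorm_scale dotp_commute)
  ultimately have "2 * l * (l * dotp p b c) \<ge> 2 * l * dotp p b (G b) - 2 * sqnorm p (G b)"
    using c_le by (simp add: right_diff_distrib)
  then have "2 * dotp p b c \<ge> 2 * dotp p b (G b) / l - 2 * sqnorm p (G b) / l\<^sup>2"
    using l by (simp add: field_simps power2_eq_square)
  moreover have "sqnorm p c \<le> sqnorm p (G b) / l\<^sup>2"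
    using c_le l by (simp add: field_simps)
  ultimately show ?thesis
    unfolding w G_def by (simp add: field_simps)
qed

text \<open>Reflecting the noise keeps the bias and flips the sign of the noise term of the error, so
  averaging the two loss values removes the cross term.\<close>

lemma ridge_reflected_loss:
  assumes l: "l > 0"
    and b1: "\<And>j. j < p \<Longrightarrow> gramv n p X b1 j + l * b1 j = (\<Sum>i<n. X i j * y i)"
    and b2: "\<And>j. j < p \<Longrightarrow> gramv n p X b2 j + l * b2 j = (\<Sum>i<n. X i j * (2 * dotp p (X i) \<beta> - y i))"
  shows "sqnorm p (\<lambda>j. b1 j - \<beta> j) + sqnorm p (\<lambda>j. b2 j - \<beta> j)
    \<le> 2 * (sqnorm p \<beta> - 2 * dotp p \<beta> (gramv n p X \<beta>) / l + 3 * sqnorm p (gramv n p X \<beta>) / l\<^sup>2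
          + sqnorm p (\<lambda>j. \<Sum>i<n. X i j * (y i - dotp p (X i) \<beta>)) / l\<^sup>2)"
proof -
  \<comment> \<open>The two errors are \<open>v - u\<close> and \<open>- (v + u)\<close>, so by the
    parallelogram law only squares remain. \<open>u\<close> satisfies the bias equation, and
    \<open>v\<close> the normal equations with the noise \<open>y - X \<beta>\<close> as
    response.\<close>
  define u where "u j = \<beta> j - (1/2) * (b1 j + b2 j)" for j
  define v where "v j = (1/2) * (b1 j - b2 j)" for j
  have "sqnorm p u \<le> sqnorm p \<beta> - 2 * dotp p \<beta> (gramv n p X \<beta>) / l + 3 * sqnorm p (gramv n p X \<beta>) / l\<^sup>2"
  proof (rule ridge_bias_bound[OF l])
    fix j assume j: "j < p"
    have "gramv n p X u j + l * u j = gramv n p X \<beta> j + l * \<beta> j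
       - (1/2) * ((gramv n p X b1 j + l * b1 j) + (gramv n p X b2 j + l * b2 j))"
      unfolding u_def[abs_def] gramv_diff gramv_scale gramv_add by (simp add: algebra_simps)
    also have "\<dots> = gramv n p X \<beta> j + l * \<beta> j - (\<Sum>i<n. X i j * dotp p (X i) \<beta>)"
      unfolding b1[OF j] b2[OF j] by (simp add: sum_distrib_left flip: sum.distrib) (simp add: algebra_simps)
    finally show "gramv n p X u j + l * u j = l * \<beta> j" by (simp add: gramv_def)
  qed
  moreover have "l\<^sup>2 * sqnorm p v \<le> sqnorm p (\<lambda>j. \<Sum>i<n. X i j * (y i - dotp p (X i) \<beta>))"
  proof (rule sqnorm_regularised_le[OF l])
    fix j assume j: "j < p"
    have "gramv n p X v j + l * v j = (1/2) * ((gramv n p X b1 j + l * b1 j) - (gramv n p X b2 j + l * b2 j))"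
      unfolding v_def[abs_def] gramv_diff gramv_scale
      by (simp add: algebra_simps add_divide_distrib diff_divide_distrib)
    also have "\<dots> = (\<Sum>i<n. X i j * (y i - dotp p (X i) \<beta>))"
      unfolding b1[OF j] b2[OF j] by (simp add: right_diff_distrib sum_subtractf sum_distrib_left)
    finally show "gramv n p X v j + l * v j = (\<Sum>i<n. X i j * (y i - dotp p (X i) \<beta>))" .
  qed
  then have "sqnorm p v \<le> sqnorm p (\<lambda>j. \<Sum>i<n. X i j * (y i - dotp p (X i) \<beta>)) / l\<^sup>2"
    using l by (simp add: field_simps)
  ultimately have le: "sqnorm p u + sqnorm p v \<le> sqnorm p \<beta> - 2 * dotp p \<beta> (gramv n p X \<beta>) / l + 3 * sqnorm p (gramv n p X \<beta>) / l\<^sup>2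
          + sqnorm p (\<lambda>j. \<Sum>i<n. X i j * (y i - dotp p (X i) \<beta>)) / l\<^sup>2"
    by (rule add_mono)
  have "sqnorm p (\<lambda>j. b1 j - \<beta> j) + sqnorm p (\<lambda>j. b2 j - \<beta> j) = 2 * (sqnorm p u + sqnorm p v)"
  proof -
    have "(\<lambda>j. b1 j - \<beta> j) = (\<lambda>j. v j - u j)" 
      by (simp add: u_def v_def fun_eq_iff add_divide_distrib diff_divide_distrib)
    moreover have "sqnorm p (\<lambda>j. b2 j - \<beta> j) = sqnorm p (\<lambda>j. v j + u j)"
      unfolding sqnorm_def by (intro sum.cong refl) (simp add: u_def v_def field_simps power2_eq_square)
    ultimately show ?thesis by (simp add: sqnorm_add sqnorm_diff)
  qed
  with le show ?thesis by simp
qed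

section \<open>Gaussian integrals and moments\<close>

text \<open>Named so that one computation serves both sources of randomness: the noise law is the
  case \<open>n = 1\<close>. At \<open>n = 0\<close> the standard deviation degenerates to 0, which
  explains the recurring hypothesis \<open>n > 0\<close>.\<close>

definition coord_dist :: "nat \<Rightarrow> real measure" where
  "coord_dist n = density lborel (\<lambda>t. ennreal (normal_density 0 (1 / sqrt (real n)) t))"

lemma sets_coord_dist [simp, measurable_cong]: "sets (coord_dist n) = sets borel"
  by (simp add: coord_dist_def)

lemma sets_noise_dist [simp, measurable_cong]: "sets noise_dist = sets borel"
  by (simp add: noise_dist_def)

lemma design_dist_eq: "design_dist n p = (\<Pi>\<^sub>M j\<in>{..<p}. coord_dist n)"
  by (simp add: design_dist_def coord_dist_def)

lemma sets_design_dist [simp, measurable_cong]: "sets (design_dist n p) = sets (vec_space p)"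
  unfolding design_dist_eq by (intro sets_PiM_cong) auto

lemma sets_obs_dist [simp, measurable_cong]: "sets (obs_dist n p \<sigma> \<beta>) = sets (borel \<Otimes>\<^sub>M vec_space p)"
  by (simp add: obs_dist_def)

lemma sets_data_dist [simp, measurable_cong]: "sets (data_dist n p \<sigma> \<beta>) = sets (data_space n p)"
  unfolding data_dist_def data_space_def by (intro sets_PiM_cong) auto

lemma prob_space_coord_dist: "n > 0 \<Longrightarrow> prob_space (coord_dist n)"
  unfolding coord_dist_def by (intro prob_space_normal_density) simp

lemma prob_space_noise_dist: "prob_space noise_dist"
  unfolding noise_dist_def by (intro prob_space_normal_density) simp

lemma prob_space_design_dist: "n > 0 \<Longrightarrow> prob_space (design_dist n p)"
  unfolding design_dist_eq by (intro prob_space_PiM prob_space_coord_dist)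

lemma measurable_dotp [measurable]: "(\<lambda>x. dotp p x b) \<in> borel_measurable (vec_space p)"
  unfolding dotp_def by measurable

lemma measurable_obs_map:
  "(\<lambda>(x, z). (dotp p x \<beta> + \<sigma> * z, x)) \<in> design_dist n p \<Otimes>\<^sub>M noise_dist \<rightarrow>\<^sub>M borel \<Otimes>\<^sub>M vec_space p"
  by measurable

lemma pair_prob_space_design_noise:
  assumes "n > 0"
  shows "pair_prob_space (design_dist n p) noise_dist"
proof -
  interpret D: prob_space "design_dist n p" using assms by (rule prob_space_design_dist)
  interpret N: prob_space noise_dist by (rule prob_space_noise_dist)
  show ?thesis ..
qed

lemma prob_space_obs_dist:
  assumes "n > 0"
  shows "prob_space (obs_dist n p \<sigma> \<beta>)"
proof -
  interpret P: pair_prob_space "design_dist n p" noise_dist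
    using assms by (rule pair_prob_space_design_noise)
  show ?thesis unfolding obs_dist_def
    by (intro P.prob_space_distr measurable_obs_map)
qed

lemma prob_space_data_dist: "n > 0 \<Longrightarrow> prob_space (data_dist n p \<sigma> \<beta>)"
  unfolding data_dist_def by (intro prob_space_PiM prob_space_obs_dist)

lemma nn_integral_obs_dist:
  assumes [measurable]: "F \<in> borel_measurable (borel \<Otimes>\<^sub>M vec_space p)"
  shows "(\<integral>\<^sup>+ w. F w \<partial>obs_dist n p \<sigma> \<beta>)
    = (\<integral>\<^sup>+ x. \<integral>\<^sup>+ z. F (dotp p x \<beta> + \<sigma> * z, x) \<partial>noise_dist \<partial>design_dist n p)"
proof -
  interpret N: prob_space noise_dist by (rule prob_space_noise_dist)
  have "(\<integral>\<^sup>+ w. F w \<partial>obs_dist n p \<sigma> \<beta>)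
     = (\<integral>\<^sup>+ w. F (case w of (x, z) \<Rightarrow> (dotp p x \<beta> + \<sigma> * z, x)) \<partial>(design_dist n p \<Otimes>\<^sub>M noise_dist))"
    unfolding obs_dist_def by (subst nn_integral_distr) (simp_all add: measurable_obs_map)
  also have "\<dots> = (\<integral>\<^sup>+ x. \<integral>\<^sup>+ z. F (dotp p x \<beta> + \<sigma> * z, x) \<partial>noise_dist \<partial>design_dist n p)"
    by (subst N.nn_integral_fst[symmetric]) simp_all
  finally show ?thesis .
qed

lemma nn_integral_noise_dist:
  assumes [measurable]: "f \<in> borel_measurable borel"
  shows "(\<integral>\<^sup>+ z. f z \<partial>noise_dist) = (\<integral>\<^sup>+ z. ennreal (std_normal_density z) * f z \<partial>lborel)"
  unfolding noise_dist_def by (subst nn_integral_density) simp_all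

lemma nn_integral_normal_density: "s > 0 \<Longrightarrow> (\<integral>\<^sup>+ x. ennreal (normal_density m s x) \<partial>lborel) = 1"
  by (subst nn_integral_eq_integral) simp_all

text \<open>Translating a standard normal by \<open>a\<close> multiplies its density by
  \<open>exp (a * z - a\<^sup>2 / 2)\<close> (Cameron--Martin). All likelihood ratios below rest on
  this, and the constant integrand already gives the moment generating function.\<close>

lemma nn_integral_noise_dist_shift:
  assumes [measurable]: "f \<in> borel_measurable borel"
  shows "(\<integral>\<^sup>+ z. f (z + a) \<partial>noise_dist) = (\<integral>\<^sup>+ z. ennreal (exp (a * z - a\<^sup>2 / 2)) * f z \<partial>noise_dist)"
proof -
  have "std_normal_density (- a + 1 * z) = std_normal_density z * exp (a * z - a\<^sup>2 / 2)" for z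
    by (simp add: std_normal_density_def power2_eq_square field_simps flip: exp_add)
  then have "ennreal (std_normal_density (- a + 1 * z)) * f (- a + 1 * z + a)
      = ennreal (std_normal_density z) * (ennreal (exp (a * z - a\<^sup>2 / 2)) * f z)" for z
    by (simp add: ennreal_mult mult.assoc)
  then show ?thesis
    by (subst (1 2) nn_integral_noise_dist, simp, simp)
       (subst nn_integral_real_affine[where c = 1 and t = "- a"], simp_all)
qed

lemma nn_integral_noise_exp: "(\<integral>\<^sup>+ z. ennreal (exp (a * z)) \<partial>noise_dist) = ennreal (exp (a\<^sup>2 / 2))"
proof -
  interpret N: prob_space noise_dist by (rule prob_space_noise_dist)
  have "(\<integral>\<^sup>+ z. 1 \<partial>noise_dist) = (\<integral>\<^sup>+ z. ennreal (exp (a * z - a\<^sup>2 / 2)) * 1 \<partial>noise_dist)"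
    by (rule nn_integral_noise_dist_shift[of "\<lambda>_. 1"]) simp
  also have "\<dots> = (\<integral>\<^sup>+ z. ennreal (exp (a * z)) * ennreal (exp (- a\<^sup>2 / 2)) \<partial>noise_dist)"
    by (simp flip: ennreal_mult exp_add)
  also have "\<dots> = (\<integral>\<^sup>+ z. ennreal (exp (a * z)) \<partial>noise_dist) * ennreal (exp (- a\<^sup>2 / 2))"
    by (rule nn_integral_multc) simp
  finally have "ennreal (exp (a\<^sup>2 / 2)) * 1 = ennreal (exp (a\<^sup>2 / 2)) * ((\<integral>\<^sup>+ z. ennreal (exp (a * z)) \<partial>noise_dist) * ennreal (exp (- a\<^sup>2 / 2)))"
    by (simp add: N.emeasure_space_1)
  also have "\<dots> = (\<integral>\<^sup>+ z. ennreal (exp (a * z)) \<partial>noise_dist) * (ennreal (exp (a\<^sup>2 / 2)) * ennreal (exp (- a\<^sup>2 / 2)))"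
    by (simp add: mult_ac)
  also have "ennreal (exp (a\<^sup>2 / 2)) * ennreal (exp (- a\<^sup>2 / 2)) = 1"
    by (simp flip: ennreal_mult exp_add)
  finally show ?thesis by simp
qed

text \<open>The tilted density is again a centred Gaussian up to a constant, with variance divided
  by \<open>v = 1 - 2 * c / n\<close>; the condition on \<open>c\<close> says \<open>v > 0\<close>.
  Negative \<open>c\<close> occurs later.\<close>

lemma nn_integral_coord_exp_square:
  assumes n: "n > 0" and c: "2 * c < real n"
  shows "(\<integral>\<^sup>+ x. ennreal (exp (c * x\<^sup>2)) \<partial>coord_dist n) = ennreal (1 / sqrt (1 - 2 * c / real n))"
proof -
  define s where "s = 1 / sqrt (real n)"
  define v where "v = 1 - 2 * c / real n"
  have s: "s > 0" "s\<^sup>2 = 1 / real n" using n by (simp_all add: s_def power_divide)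
  have v: "v > 0" using n c by (simp add: v_def)
  have eq: "normal_density 0 s x * exp (c * x\<^sup>2) = 1 / sqrt v * normal_density 0 (s / sqrt v) x" for x
  proof -
    have "- x\<^sup>2 / (2 * s\<^sup>2) + c * x\<^sup>2 = - x\<^sup>2 / (2 * (s / sqrt v)\<^sup>2)"
      using n v by (simp add: s power_divide v_def field_simps)
    moreover have "sqrt (2 * pi * (s / sqrt v)\<^sup>2) = sqrt (2 * pi * s\<^sup>2) / sqrt v"
      using v by (simp add: power_divide real_sqrt_divide)
    ultimately show ?thesis
      using v by (simp add: normal_density_def flip: exp_add)
  qed
  have "(\<integral>\<^sup>+ x. ennreal (exp (c * x\<^sup>2)) \<partial>coord_dist n)
      = (\<integral>\<^sup>+ x. ennreal (normal_density 0 s x) * ennreal (exp (c * x\<^sup>2)) \<partial>lborel)"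
    unfolding coord_dist_def s_def by (subst nn_integral_density) simp_all
  also have "\<dots> = (\<integral>\<^sup>+ x. ennreal (1 / sqrt v) * ennreal (normal_density 0 (s / sqrt v) x) \<partial>lborel)"
    using v by (simp add: eq flip: ennreal_mult)
  also have "\<dots> = ennreal (1 / sqrt v)"
    using s v by (simp add: nn_integral_cmult nn_integral_normal_density)
  finally show ?thesis by (simp add: v_def)
qed

lemma coord_power_integral:
  assumes "n > 0"
  shows "integrable (coord_dist n) (\<lambda>x. x ^ e)"
    and "(\<integral>x. x ^ e \<partial>coord_dist n) = (\<integral>x. normal_density 0 (1 / sqrt (real n)) x * x ^ e \<partial>lborel)"
  using integrable_normal_moment[of "1 / sqrt (real n)" 0 e] assms unfolding coord_dist_def
  by (simp_all add: integrable_real_density integral_real_density)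

lemma coord_moments:
  assumes "n > 0"
  shows "odd e \<Longrightarrow> (\<integral>x. x ^ e \<partial>coord_dist n) = 0"
    and "(\<integral>x. x ^ 0 \<partial>coord_dist n) = 1"
    and "(\<integral>x. x\<^sup>2 \<partial>coord_dist n) = 1 / real n"
    and "(\<integral>x. x ^ 4 \<partial>coord_dist n) = 3 / (real n)\<^sup>2"
proof -
  have s: "0 < 1 / sqrt (real n)" using assms by simp
  show "(\<integral>x. x ^ e \<partial>coord_dist n) = 0" if "odd e"
  proof -
    obtain k where "e = 2 * k + 1" using \<open>odd e\<close> by (elim oddE)
    then show ?thesis
      using integral_normal_moment_odd[OF s, of 0 k]
      by (simp only: coord_power_integral(2)[OF assms] diff_zero)
  qed
  show "(\<integral>x. x ^ 0 \<partial>coord_dist n) = 1"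
    using assms by (simp only: coord_power_integral(2)) simp
  show "(\<integral>x. x\<^sup>2 \<partial>coord_dist n) = 1 / real n"
    using integral_normal_moment_even[OF s, of 0 1] assms
    by (simp add: coord_power_integral(2) power_divide)
  have "(fact (2 * 2) :: real) / ((2 / (1 / sqrt (real n))\<^sup>2) ^ 2 * fact 2) = 3 / (real n)\<^sup>2"
    using assms by (simp add: fact_numeral power_divide)
  then show "(\<integral>x. x ^ 4 \<partial>coord_dist n) = 3 / (real n)\<^sup>2"
    using integral_normal_moment_even[OF s, of 0 2] assms
    by (simp add: coord_power_integral(2))
qed

lemma noise_dist_eq: "noise_dist = coord_dist 1"
  by (simp add: noise_dist_def coord_dist_def)

section \<open>Polynomial moments of the design\<close>

lemma prod_monomial:
  fixes x :: "nat \<Rightarrow> real"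
  shows "a < p \<Longrightarrow> (\<Prod>i<p. x i ^ of_bool (i = a)) = x a"
  by (simp add: of_bool_def if_distrib prod.delta cong: if_cong)

lemma design_monomial:
  assumes "n > 0"
  shows "integrable (design_dist n p) (\<lambda>x. \<Prod>i<p. x i ^ e i)"
    and "(\<integral>x. (\<Prod>i<p. x i ^ e i) \<partial>design_dist n p) = (\<Prod>i<p. \<integral>x. x ^ e i \<partial>coord_dist n)"
proof -
  interpret C: prob_space "coord_dist n" using assms by (rule prob_space_coord_dist)
  interpret P: product_prob_space "\<lambda>_::nat. coord_dist n" ..
  show "integrable (design_dist n p) (\<lambda>x. \<Prod>i<p. x i ^ e i)"
    unfolding design_dist_eq using assms
    by (intro P.product_integrable_prod coord_power_integral) auto
  show "(\<integral>x. (\<Prod>i<p. x i ^ e i) \<partial>design_dist n p) = (\<Prod>i<p. \<integral>x. x ^ e i \<partial>coord_dist n)"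
    unfolding design_dist_eq using assms
    by (intro P.product_integral_prod coord_power_integral) auto
qed

text \<open>A product of coordinates is a monomial with exponent vector \<open>e\<close>.
  Independence factors its mean, and a single odd exponent makes it vanish.\<close>

lemma design_second_moment:
  assumes n: "n > 0" and ab: "a < p" "b < p"
  shows "has_bochner_integral (design_dist n p) (\<lambda>x. x a * x b) (of_bool (a = b) / real n)"
proof -
  define e :: "nat \<Rightarrow> nat" where "e i = of_bool (i = a) + of_bool (i = b)" for i
  have *: "(\<lambda>x::nat \<Rightarrow> real. x a * x b) = (\<lambda>x. \<Prod>i<p. x i ^ e i)"
    using ab by (simp add: e_def power_add prod.distrib prod_monomial)
  have "(\<Prod>i<p. \<integral>x. x ^ e i \<partial>coord_dist n) = of_bool (a = b) / real n"
  proof (cases "a = b")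
    case True
    have "(\<Prod>i<p. \<integral>x. x ^ e i \<partial>coord_dist n) = (\<Prod>i<p. if i = a then 1 / real n else 1)"
      using n coord_moments(2,3)[of n] by (intro prod.cong) (auto simp: e_def True numeral_2_eq_2)
    then show ?thesis using ab True by simp
  next
    case False
    have "(\<integral>x. x ^ e a \<partial>coord_dist n) = 0"
      using n False by (intro coord_moments) (auto simp: e_def)
    then show ?thesis using False ab by (auto intro!: prod_zero)
  qed
  then show ?thesis
    unfolding * has_bochner_integral_iff using design_monomial[OF n, of p e] by simp
qed

text \<open>Isserlis' formula with one index repeated: if \<open>a\<close> and \<open>b\<close>
  differ, some exponent is odd; an exponent 4 gives 3, and two exponents 2 give 1.\<close>

lemma design_fourth_moment:
  assumes n: "n > 0" and ab: "a < p" "b < p" "j < p"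
  shows "has_bochner_integral (design_dist n p) (\<lambda>x. (x j)\<^sup>2 * (x a * x b))
    (of_bool (a = b) * (if a = j then 3 else 1) / (real n)\<^sup>2)"
proof -
  define e :: "nat \<Rightarrow> nat" where "e i = of_bool (i = j) + of_bool (i = j) + (of_bool (i = a) + of_bool (i = b))" for i
  have *: "(\<lambda>x::nat \<Rightarrow> real. (x j)\<^sup>2 * (x a * x b)) = (\<lambda>x. \<Prod>i<p. x i ^ e i)"
    using ab by (simp add: e_def power_add prod.distrib prod_monomial power2_eq_square)
  have "(\<Prod>i<p. \<integral>x. x ^ e i \<partial>coord_dist n) = of_bool (a = b) * (if a = j then 3 else 1) / (real n)\<^sup>2"
  proof (cases "a = b")
    case ne: True
    show ?thesis
    proof (cases "a = j")
      case True
      have "(\<Prod>i<p. \<integral>x. x ^ e i \<partial>coord_dist n) = (\<Prod>i<p. if i = a then 3 / (real n)\<^sup>2 else 1)"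
        using n coord_moments(2,4)[of n]
        by (intro prod.cong) (auto simp: e_def True ne[symmetric] numeral_eq_Suc)
      then show ?thesis using ab True ne by simp
    next
      case False
      have "(\<Prod>i<p. \<integral>x. x ^ e i \<partial>coord_dist n)
          = (\<Prod>i<p. (if i = a then 1 / real n else 1) * (if i = j then 1 / real n else 1))"
        using n coord_moments(2,3)[of n] False
        by (intro prod.cong) (auto simp: e_def ne[symmetric] numeral_2_eq_2)
      then show ?thesis using ab False ne by (simp add: prod.distrib power2_eq_square)
    qed
  next
    case False
    have "(\<integral>x. x ^ e a \<partial>coord_dist n) = 0"
      using n False by (intro coord_moments) (auto simp: e_def)
    then show ?thesis using False ab by (auto intro!: prod_zero)
  qed
  then show ?thesis
    unfolding * has_bochner_integral_iff using design_monomial[OF n, of p e] by simp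
qed

lemma dotp_square: "(dotp p x \<beta>)\<^sup>2 = (\<Sum>a<p. \<Sum>b<p. \<beta> a * \<beta> b * (x a * x b))"
  by (simp add: dotp_def power2_eq_square sum_product mult_ac)

text \<open>The third integral is
  \<open>(sqnorm p \<beta> + 2 * (\<beta> j)\<^sup>2) / n\<^sup>2\<close>; the cruder bound suffices
  because it enters the risk only at order \<open>1 / l\<^sup>2\<close>.\<close>

lemma design_dotp_moments:
  assumes n: "n > 0"
  shows "has_bochner_integral (design_dist n p) (\<lambda>x. (dotp p x \<beta>)\<^sup>2) (sqnorm p \<beta> / real n)"
    and "j < p \<Longrightarrow> has_bochner_integral (design_dist n p) (\<lambda>x. x j * dotp p x \<beta>) (\<beta> j / real n)"
    and "j < p \<Longrightarrow> \<exists>I\<le>3 * sqnorm p \<beta> / (real n)\<^sup>2.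
      has_bochner_integral (design_dist n p) (\<lambda>x. (x j * dotp p x \<beta>)\<^sup>2) I"
proof -
  have "has_bochner_integral (design_dist n p) (\<lambda>x. (dotp p x \<beta>)\<^sup>2)
      (\<Sum>a<p. \<Sum>b<p. \<beta> a * \<beta> b * (of_bool (a = b) / real n))"
    unfolding dotp_square using n
    by (intro has_bochner_integral_sum has_bochner_integral_mult_right design_second_moment) auto
  also have "(\<Sum>a<p. \<Sum>b<p. \<beta> a * \<beta> b * (of_bool (a = b) / real n)) = sqnorm p \<beta> / real n"
  proof -
    have "(\<Sum>a<p. \<Sum>b<p. \<beta> a * \<beta> b * (of_bool (a = b) / real n)) = (\<Sum>a<p. \<Sum>b<p. if a = b then (\<beta> a)\<^sup>2 / real n else 0)"
      by (intro sum.cong refl) (simp add: power2_eq_square)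
    then show ?thesis by (simp add: sqnorm_def sum_divide_distrib)
  qed
  finally show "has_bochner_integral (design_dist n p) (\<lambda>x. (dotp p x \<beta>)\<^sup>2) (sqnorm p \<beta> / real n)" .
  assume j: "j < p"
  have "has_bochner_integral (design_dist n p) (\<lambda>x. \<Sum>a<p. \<beta> a * (x j * x a))
      (\<Sum>a<p. \<beta> a * (of_bool (j = a) / real n))"
    using n j by (intro has_bochner_integral_sum has_bochner_integral_mult_right design_second_moment) auto
  also have "(\<lambda>x. \<Sum>a<p. \<beta> a * (x j * x a)) = (\<lambda>x. x j * dotp p x \<beta>)"
    by (simp add: dotp_def sum_distrib_left mult_ac)
  also have "(\<Sum>a<p. \<beta> a * (of_bool (j = a) / real n)) = \<beta> j / real n"
  proof -
    have "(\<Sum>a<p. \<beta> a * (of_bool (j = a) / real n)) = (\<Sum>a<p. if j = a then \<beta> j / real n else 0)"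
      by (intro sum.cong refl) simp
    then show ?thesis using j by simp
  qed
  finally show "has_bochner_integral (design_dist n p) (\<lambda>x. x j * dotp p x \<beta>) (\<beta> j / real n)" .
  define I where "I = (\<Sum>a<p. \<Sum>b<p. \<beta> a * \<beta> b * (of_bool (a = b) * (if a = j then 3 else 1) / (real n)\<^sup>2))"
  have "has_bochner_integral (design_dist n p) (\<lambda>x. \<Sum>a<p. \<Sum>b<p. \<beta> a * \<beta> b * ((x j)\<^sup>2 * (x a * x b))) I"
    unfolding I_def using n j
    by (intro has_bochner_integral_sum has_bochner_integral_mult_right design_fourth_moment) auto
  also have "(\<lambda>x. \<Sum>a<p. \<Sum>b<p. \<beta> a * \<beta> b * ((x j)\<^sup>2 * (x a * x b))) = (\<lambda>x. (x j * dotp p x \<beta>)\<^sup>2)"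
    by (simp add: power_mult_distrib dotp_square sum_distrib_left mult_ac)
  finally have "has_bochner_integral (design_dist n p) (\<lambda>x. (x j * dotp p x \<beta>)\<^sup>2) I" .
  moreover have "I = (\<Sum>a<p. (if a = j then 3 else 1) * ((\<beta> a)\<^sup>2 / (real n)\<^sup>2))"
  proof -
    have "I = (\<Sum>a<p. \<Sum>b<p. if a = b then (if a = j then 3 else 1) * ((\<beta> a)\<^sup>2 / (real n)\<^sup>2) else 0)"
      unfolding I_def by (intro sum.cong refl) (simp add: power2_eq_square)
    then show ?thesis by simp
  qed
  then have "I \<le> (\<Sum>a<p. 3 * ((\<beta> a)\<^sup>2 / (real n)\<^sup>2))"
    by (auto intro!: sum_mono divide_right_mono)
  then have "I \<le> 3 * sqnorm p \<beta> / (real n)\<^sup>2"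
    by (simp add: sqnorm_def sum_distrib_left sum_divide_distrib)
  ultimately show "\<exists>I\<le>3 * sqnorm p \<beta> / (real n)\<^sup>2.
      has_bochner_integral (design_dist n p) (\<lambda>x. (x j * dotp p x \<beta>)\<^sup>2) I" by blast
qed

text \<open>The residual \<open>y - dotp p x \<beta>\<close> is \<open>\<sigma> * z\<close> with
  \<open>z\<close> independent of \<open>x\<close>, so Fubini gives a product. Exponent 0 serves
  functions of the design alone, exponents 1 and 2 the noise term.\<close>

lemma obs_moment:
  assumes n: "n > 0" and g: "has_bochner_integral (design_dist n p) g I"
  shows "has_bochner_integral (obs_dist n p \<sigma> \<beta>) (\<lambda>(y, x). g x * (y - dotp p x \<beta>) ^ e)
    (I * (\<sigma> ^ e * (\<integral>z. z ^ e \<partial>noise_dist)))"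
proof -
  interpret P: pair_prob_space "design_dist n p" noise_dist
    using n by (rule pair_prob_space_design_noise)
  have [measurable]: "g \<in> borel_measurable (design_dist n p)"
    using g by (auto simp: has_bochner_integral_iff)
  have gm [measurable]: "g \<in> borel_measurable (vec_space p)"
    using \<open>g \<in> borel_measurable (design_dist n p)\<close> by simp
  have ig: "integrable (design_dist n p) g" "integral\<^sup>L (design_dist n p) g = I"
    using g by (auto simp: has_bochner_integral_iff)
  have iz: "integrable noise_dist (\<lambda>z. z ^ e)"
    unfolding noise_dist_eq by (rule coord_power_integral) simp
  then have iz': "integrable noise_dist (\<lambda>z. (\<sigma> * z) ^ e)"
    by (simp add: power_mult_distrib)
  have int: "integrable (design_dist n p \<Otimes>\<^sub>M noise_dist) (\<lambda>(x, z). g x * (\<sigma> * z) ^ e)"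
    using ig iz' by (intro P.Fubini_integrable) (simp_all add: abs_mult)
  have "(\<integral>w. (case w of (x, z) \<Rightarrow> g x * (\<sigma> * z) ^ e) \<partial>(design_dist n p \<Otimes>\<^sub>M noise_dist))
      = (\<integral>x. (\<integral>z. g x * (\<sigma> * z) ^ e \<partial>noise_dist) \<partial>design_dist n p)"
    using P.integral_fst[OF int] by simp
  also have "\<dots> = I * (\<sigma> ^ e * (\<integral>z. z ^ e \<partial>noise_dist))"
    using ig by (simp add: power_mult_distrib)
  finally have "has_bochner_integral (design_dist n p \<Otimes>\<^sub>M noise_dist) (\<lambda>(x, z). g x * (\<sigma> * z) ^ e)
      (I * (\<sigma> ^ e * (\<integral>z. z ^ e \<partial>noise_dist)))"
    using int by (simp add: has_bochner_integral_iff)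
  then show ?thesis
    unfolding obs_dist_def
    by (intro has_bochner_integral_distr measurable_obs_map) (simp_all add: case_prod_beta')
qed

text \<open>The diagonal contributes \<open>n * v\<close>; by independence each of the
  \<open>n * (n - 1)\<close> mixed terms contributes \<open>m\<^sup>2\<close>, and their number is
  rounded up to \<open>n\<^sup>2\<close>.\<close>

lemma has_bochner_integral_iid_sum_square:
  fixes F :: "'a \<Rightarrow> real"
  assumes N: "prob_space N" and F: "has_bochner_integral N F m" and F2: "has_bochner_integral N (\<lambda>w. (F w)\<^sup>2) v"
  shows "\<exists>I \<le> real n * v + (real n * m)\<^sup>2.
    has_bochner_integral (\<Pi>\<^sub>M i\<in>{..<n}. N) (\<lambda>d. (\<Sum>i<n. F (d i))\<^sup>2) I"
proof -
  interpret N: prob_space N by fact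
  interpret P: product_prob_space "\<lambda>_::nat. N" ..
  have [measurable]: "F \<in> borel_measurable N" using F by (auto simp: has_bochner_integral_iff)
  have diag: "has_bochner_integral (\<Pi>\<^sub>M i\<in>{..<n}. N) (\<lambda>d. F (d a) * F (d a)) v" if "a < n" for a
  proof -
    have "has_bochner_integral (distr (\<Pi>\<^sub>M i\<in>{..<n}. N) N (\<lambda>d. d a)) (\<lambda>w. (F w)\<^sup>2) v"
      using that F2 by (subst distr_PiM_component) (auto intro: N)
    moreover have "(\<lambda>d. d a) \<in> (\<Pi>\<^sub>M i\<in>{..<n}. N) \<rightarrow>\<^sub>M N"
      using that by (intro measurable_component_singleton) simp
    ultimately show ?thesis
      by (simp add: has_bochner_integral_iff integrable_distr_eq integral_distr power2_eq_square)
  qed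
  have off: "has_bochner_integral (\<Pi>\<^sub>M i\<in>{..<n}. N) (\<lambda>d. F (d a) * F (d b)) (m * m)"
    if ab: "a < n" "b < n" "a \<noteq> b" for a b
  proof -
    define G where "G i w = (if i = a then F w else 1) * (if i = b then F w else 1)" for i w
    have intG: "integrable N (G i)" for i
      using F ab by (cases "i = a"; cases "i = b") (auto simp: G_def[abs_def] has_bochner_integral_iff)
    have "(\<Prod>i<n. integral\<^sup>L N (G i)) = (\<Prod>i<n. (if i = a then m else 1) * (if i = b then m else 1))"
      using F ab by (intro prod.cong) (auto simp: G_def[abs_def] has_bochner_integral_iff N.prob_space)
    also have "\<dots> = m * m" using ab by (simp add: prod.distrib)
    finally have "has_bochner_integral (\<Pi>\<^sub>M i\<in>{..<n}. N) (\<lambda>d. \<Prod>i<n. G i (d i)) (m * m)"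
      using P.product_integrable_prod[of "{..<n}" G] P.product_integral_prod[of "{..<n}" G] intG
      by (simp add: has_bochner_integral_iff)
    moreover have "(\<Prod>i<n. G i (d i)) = F (d a) * F (d b)" for d
      using ab by (simp add: G_def prod.distrib)
    ultimately show ?thesis by simp
  qed
  define I where "I = (\<Sum>a<n. \<Sum>b<n. if a = b then v else m * m)"
  have "has_bochner_integral (\<Pi>\<^sub>M i\<in>{..<n}. N) (\<lambda>d. \<Sum>a<n. \<Sum>b<n. F (d a) * F (d b)) I"
    unfolding I_def using diag off
    by (intro has_bochner_integral_sum) auto
  then have "has_bochner_integral (\<Pi>\<^sub>M i\<in>{..<n}. N) (\<lambda>d. (\<Sum>i<n. F (d i))\<^sup>2) I"
    by (simp add: power2_eq_square sum_product)
  moreover have "I \<le> (\<Sum>a<n. \<Sum>b<n. (if a = b then v else 0) + m * m)"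
    unfolding I_def by (intro sum_mono) auto
  then have "I \<le> real n * v + (real n * m)\<^sup>2"
    by (simp add: sum.distrib power2_eq_square algebra_simps)
  ultimately show ?thesis by blast
qed

section \<open>Risk of the ridge estimator\<close>

lemma gram_moments:
  assumes n: "n > 0"
  shows "has_bochner_integral (data_dist n p \<sigma> \<beta>)
      (\<lambda>d. dotp p \<beta> (gramv n p (\<lambda>i. snd (d i)) \<beta>)) (sqnorm p \<beta>)"
    and "\<exists>I \<le> sqnorm p \<beta> * (1 + 3 * real p / real n). has_bochner_integral (data_dist n p \<sigma> \<beta>)
      (\<lambda>d. sqnorm p (gramv n p (\<lambda>i. snd (d i)) \<beta>)) I"
    and "\<exists>I \<le> real p * \<sigma>\<^sup>2. has_bochner_integral (data_dist n p \<sigma> \<beta>)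
      (\<lambda>d. sqnorm p (\<lambda>j. \<Sum>i<n. snd (d i) j * (fst (d i) - dotp p (snd (d i)) \<beta>))) I"
proof -
  interpret O: prob_space "obs_dist n p \<sigma> \<beta>" using n by (rule prob_space_obs_dist)
  let ?O = "obs_dist n p \<sigma> \<beta>"
  have z: "(\<integral>z. z ^ 0 \<partial>noise_dist) = 1" "(\<integral>z. z ^ 1 \<partial>noise_dist) = 0" "(\<integral>z. z\<^sup>2 \<partial>noise_dist) = 1"
    unfolding noise_dist_eq using coord_moments(2,3)[of 1] coord_moments(1)[of 1 1] by auto
  have x_only: "has_bochner_integral ?O (\<lambda>w. g (snd w)) I"
    if "has_bochner_integral (design_dist n p) g I" for g :: "(nat \<Rightarrow> real) \<Rightarrow> real" and I
    using obs_moment[OF n that, of \<sigma> \<beta> 0] z by (simp add: case_prod_beta')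

  have "has_bochner_integral (data_dist n p \<sigma> \<beta>) (\<lambda>d. (dotp p (snd (d i)) \<beta>)\<^sup>2) (sqnorm p \<beta> / real n)"
    if i: "i < n" for i
  proof -
    have "has_bochner_integral (distr (data_dist n p \<sigma> \<beta>) ?O (\<lambda>d. d i)) (\<lambda>w. (dotp p (snd w) \<beta>)\<^sup>2) (sqnorm p \<beta> / real n)"
      using i x_only[OF design_dotp_moments(1)[OF n, of p \<beta>]] unfolding data_dist_def
      by (subst distr_PiM_component) (auto intro: O.prob_space_axioms)
    moreover have "(\<lambda>d. d i) \<in> data_dist n p \<sigma> \<beta> \<rightarrow>\<^sub>M ?O"
      using i unfolding data_dist_def by (intro measurable_component_singleton) simp
    ultimately show ?thesis
      by (simp add: has_bochner_integral_iff integrable_distr_eq integral_distr)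
  qed
  then have "has_bochner_integral (data_dist n p \<sigma> \<beta>) (\<lambda>d. \<Sum>i<n. (dotp p (snd (d i)) \<beta>)\<^sup>2)
      (\<Sum>i<n. sqnorm p \<beta> / real n)"
    by (intro has_bochner_integral_sum) auto
  then show "has_bochner_integral (data_dist n p \<sigma> \<beta>)
      (\<lambda>d. dotp p \<beta> (gramv n p (\<lambda>i. snd (d i)) \<beta>)) (sqnorm p \<beta>)"
    using n by (simp add: dotp_gramv power2_eq_square)

  \<comment> \<open>For one coordinate of \<open>X\<^sup>T X \<beta>\<close> the squared mean is
    \<open>(\<beta> j)\<^sup>2\<close> and the fluctuation costs at most
    \<open>3 * sqnorm p \<beta> / n\<close>. Summed over \<open>p\<close> coordinates, the latter
    becomes the term \<open>3 * p / n\<close>.\<close>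
  have "\<exists>I. I \<le> 3 * sqnorm p \<beta> / real n + (\<beta> j)\<^sup>2 \<and> has_bochner_integral (data_dist n p \<sigma> \<beta>)
      (\<lambda>d. (gramv n p (\<lambda>i. snd (d i)) \<beta> j)\<^sup>2) I" if j: "j < p" for j
  proof -
    obtain v where v: "v \<le> 3 * sqnorm p \<beta> / (real n)\<^sup>2"
        "has_bochner_integral (design_dist n p) (\<lambda>x. (x j * dotp p x \<beta>)\<^sup>2) v"
      using design_dotp_moments(3)[OF n j, of \<beta>] by blast
    obtain I where I: "I \<le> real n * v + (real n * (\<beta> j / real n))\<^sup>2"
        "has_bochner_integral (data_dist n p \<sigma> \<beta>) (\<lambda>d. (\<Sum>i<n. snd (d i) j * dotp p (snd (d i)) \<beta>)\<^sup>2) I"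
      using has_bochner_integral_iid_sum_square[OF O.prob_space_axioms x_only[OF design_dotp_moments(2)[OF n j, of \<beta>]]
          x_only[OF v(2)], of n] unfolding data_dist_def by blast
    have "real n * v \<le> real n * (3 * sqnorm p \<beta> / (real n)\<^sup>2)"
      using v by (intro mult_left_mono) auto
    also have "\<dots> = 3 * sqnorm p \<beta> / real n"
      using n by (simp add: power2_eq_square)
    finally have "I \<le> 3 * sqnorm p \<beta> / real n + (\<beta> j)\<^sup>2"
      using I(1) n by simp
    with I(2) show ?thesis by (auto simp: gramv_def)
  qed
  then have "\<exists>I. \<forall>j\<in>{..<p}. I j \<le> 3 * sqnorm p \<beta> / real n + (\<beta> j)\<^sup>2 \<and> has_bochner_integral (data_dist n p \<sigma> \<beta>)
      (\<lambda>d. (gramv n p (\<lambda>i. snd (d i)) \<beta> j)\<^sup>2) (I j)"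
    by (intro bchoice) simp
  then obtain I where "\<forall>j\<in>{..<p}. I j \<le> 3 * sqnorm p \<beta> / real n + (\<beta> j)\<^sup>2 \<and> has_bochner_integral (data_dist n p \<sigma> \<beta>)
      (\<lambda>d. (gramv n p (\<lambda>i. snd (d i)) \<beta> j)\<^sup>2) (I j)" ..
  then have I: "\<And>j. j < p \<Longrightarrow> I j \<le> 3 * sqnorm p \<beta> / real n + (\<beta> j)\<^sup>2"
      "\<And>j. j < p \<Longrightarrow> has_bochner_integral (data_dist n p \<sigma> \<beta>) (\<lambda>d. (gramv n p (\<lambda>i. snd (d i)) \<beta> j)\<^sup>2) (I j)"
    by simp_all
  have "has_bochner_integral (data_dist n p \<sigma> \<beta>) (\<lambda>d. sqnorm p (gramv n p (\<lambda>i. snd (d i)) \<beta>)) (\<Sum>j<p. I j)"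
    unfolding sqnorm_def using I(2) by (intro has_bochner_integral_sum) auto
  moreover have "(\<Sum>j<p. I j) \<le> (\<Sum>j<p. 3 * sqnorm p \<beta> / real n + (\<beta> j)\<^sup>2)"
    using I(1) by (intro sum_mono) auto
  then have "(\<Sum>j<p. I j) \<le> sqnorm p \<beta> * (1 + 3 * real p / real n)"
    by (simp add: sum.distrib sqnorm_def[symmetric] algebra_simps)
  ultimately show "\<exists>I \<le> sqnorm p \<beta> * (1 + 3 * real p / real n). has_bochner_integral (data_dist n p \<sigma> \<beta>)
      (\<lambda>d. sqnorm p (gramv n p (\<lambda>i. snd (d i)) \<beta>)) I" by blast

  have "\<exists>I. I \<le> \<sigma>\<^sup>2 \<and> has_bochner_integral (data_dist n p \<sigma> \<beta>)
      (\<lambda>d. (\<Sum>i<n. snd (d i) j * (fst (d i) - dotp p (snd (d i)) \<beta>))\<^sup>2) I" if j: "j < p" for j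
  proof -
    \<comment> \<open>The second moment of a coordinate is read off by taking a unit vector for
      \<open>\<beta>\<close>.\<close>
    have "has_bochner_integral (design_dist n p) (\<lambda>x. x j * dotp p x (\<lambda>i. of_bool (i = j))) (1 / real n)"
      using design_dotp_moments(2)[OF n j, of "\<lambda>i. of_bool (i = j)"] by simp
    moreover have *: "dotp p x (\<lambda>i. of_bool (i = j)) = x j" for x
      using j by (simp add: dotp_def of_bool_def if_distrib cong: if_cong)
    ultimately have m2: "has_bochner_integral (design_dist n p) (\<lambda>x. (x j)\<^sup>2) (1 / real n)"
      by (simp add: power2_eq_square)
    have "integrable (design_dist n p) (\<lambda>x. x j)"
    proof -
      interpret C: prob_space "coord_dist n" using n by (rule prob_space_coord_dist)
      have "integrable (distr (design_dist n p) (coord_dist n) (\<lambda>x. x j)) (\<lambda>x. x ^ 1)"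
        using j coord_power_integral(1)[OF n, of 1] unfolding design_dist_eq
        by (subst distr_PiM_component) (auto intro: C.prob_space_axioms)
      then show ?thesis
        using j by (subst (asm) integrable_distr_eq) (auto simp: design_dist_eq)
    qed
    \<comment> \<open>The mean of \<open>x j\<close> can stay uncomputed: it will be multiplied by
      the mean of the noise, which is 0.\<close>
    then have m1: "has_bochner_integral (design_dist n p) (\<lambda>x. x j) (\<integral>x. x j \<partial>design_dist n p)"
      by (rule has_bochner_integral_integrable)
    have F1: "has_bochner_integral ?O (\<lambda>w. snd w j * (fst w - dotp p (snd w) \<beta>)) 0"
      using obs_moment[OF n m1, of \<sigma> \<beta> 1] z(2) by (simp add: case_prod_beta')
    have F2: "has_bochner_integral ?O (\<lambda>w. (snd w j * (fst w - dotp p (snd w) \<beta>))\<^sup>2) (\<sigma>\<^sup>2 / real n)"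
      using obs_moment[OF n m2, of \<sigma> \<beta> 2] z(3) by (simp add: case_prod_beta' power_mult_distrib)
    show ?thesis
      using has_bochner_integral_iid_sum_square[OF O.prob_space_axioms F1 F2, of n] n
      unfolding data_dist_def by simp
  qed
  then have "\<exists>J. \<forall>j\<in>{..<p}. J j \<le> \<sigma>\<^sup>2 \<and> has_bochner_integral (data_dist n p \<sigma> \<beta>)
      (\<lambda>d. (\<Sum>i<n. snd (d i) j * (fst (d i) - dotp p (snd (d i)) \<beta>))\<^sup>2) (J j)"
    by (intro bchoice) simp
  then obtain J where "\<forall>j\<in>{..<p}. J j \<le> \<sigma>\<^sup>2 \<and> has_bochner_integral (data_dist n p \<sigma> \<beta>)
      (\<lambda>d. (\<Sum>i<n. snd (d i) j * (fst (d i) - dotp p (snd (d i)) \<beta>))\<^sup>2) (J j)" ..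
  then have J: "\<And>j. j < p \<Longrightarrow> J j \<le> \<sigma>\<^sup>2"
      "\<And>j. j < p \<Longrightarrow> has_bochner_integral (data_dist n p \<sigma> \<beta>) (\<lambda>d. (\<Sum>i<n. snd (d i) j * (fst (d i) - dotp p (snd (d i)) \<beta>))\<^sup>2) (J j)"
    by simp_all
  have "has_bochner_integral (data_dist n p \<sigma> \<beta>)
     (\<lambda>d. sqnorm p (\<lambda>j. \<Sum>i<n. snd (d i) j * (fst (d i) - dotp p (snd (d i)) \<beta>))) (\<Sum>j<p. J j)"
    unfolding sqnorm_def using J(2) by (intro has_bochner_integral_sum) auto
  moreover have "(\<Sum>j<p. J j) \<le> real p * \<sigma>\<^sup>2"
    using sum_mono[of "{..<p}" J "\<lambda>_. \<sigma>\<^sup>2"] J(1) by simp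
  ultimately show "\<exists>I \<le> real p * \<sigma>\<^sup>2. has_bochner_integral (data_dist n p \<sigma> \<beta>)
      (\<lambda>d. sqnorm p (\<lambda>j. \<Sum>i<n. snd (d i) j * (fst (d i) - dotp p (snd (d i)) \<beta>))) I" by blast
qed

section \<open>Reflection of the noise\<close>

definition reflect_obs :: "nat \<Rightarrow> (nat \<Rightarrow> real) \<Rightarrow> real \<times> (nat \<Rightarrow> real) \<Rightarrow> real \<times> (nat \<Rightarrow> real)" where
  "reflect_obs p \<beta> w = (2 * dotp p (snd w) \<beta> - fst w, snd w)"

lemma measurable_reflect_obs [measurable]:
  "reflect_obs p \<beta> \<in> borel \<Otimes>\<^sub>M vec_space p \<rightarrow>\<^sub>M borel \<Otimes>\<^sub>M vec_space p"
  unfolding reflect_obs_def by measurable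

lemma nn_integral_noise_dist_reflect:
  assumes [measurable]: "f \<in> borel_measurable borel"
  shows "(\<integral>\<^sup>+ z. f (- z) \<partial>noise_dist) = (\<integral>\<^sup>+ z. f z \<partial>noise_dist)"
  by (subst (1 2) nn_integral_noise_dist, simp, simp)
     (subst nn_integral_real_affine[where c = "-1" and t = 0], simp_all add: std_normal_density_def)

text \<open>The map keeps \<open>x\<close> and replaces \<open>z\<close> by \<open>- z\<close> in
  the model with parameter \<open>\<beta>\<close>; the noise density is even.\<close>

lemma reflect_obs_dist:
  "distr (obs_dist n p \<sigma> \<beta>) (obs_dist n p \<sigma> \<beta>) (reflect_obs p \<beta>) = obs_dist n p \<sigma> \<beta>"
proof (rule measure_eqI)
  fix A assume "A \<in> sets (distr (obs_dist n p \<sigma> \<beta>) (obs_dist n p \<sigma> \<beta>) (reflect_obs p \<beta>))"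
  then have A [measurable]: "A \<in> sets (borel \<Otimes>\<^sub>M vec_space p)" by simp
  have "emeasure (distr (obs_dist n p \<sigma> \<beta>) (obs_dist n p \<sigma> \<beta>) (reflect_obs p \<beta>)) A
      = (\<integral>\<^sup>+ w. indicator A (reflect_obs p \<beta> w) \<partial>obs_dist n p \<sigma> \<beta>)"
    by (subst nn_integral_indicator[symmetric], simp, subst nn_integral_distr) (simp_all cong: measurable_cong_sets)
  also have "\<dots> = (\<integral>\<^sup>+ x. \<integral>\<^sup>+ z. indicator A (dotp p x \<beta> + \<sigma> * (- z), x) \<partial>noise_dist \<partial>design_dist n p)"
    by (subst nn_integral_obs_dist) (simp_all add: reflect_obs_def)
  also have "\<dots> = (\<integral>\<^sup>+ x. \<integral>\<^sup>+ z. indicator A (dotp p x \<beta> + \<sigma> * z, x) \<partial>noise_dist \<partial>design_dist n p)"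
  proof (rule nn_integral_cong)
    fix x assume "x \<in> space (design_dist n p)"
    then have [measurable]: "x \<in> space (vec_space p)"
      using sets_eq_imp_space_eq[OF sets_design_dist] by blast
    show "(\<integral>\<^sup>+ z. indicator A (dotp p x \<beta> + \<sigma> * (- z), x) \<partial>noise_dist)
        = (\<integral>\<^sup>+ z. indicator A (dotp p x \<beta> + \<sigma> * z, x) \<partial>noise_dist)"
      by (rule nn_integral_noise_dist_reflect[of "\<lambda>z. indicator A (dotp p x \<beta> + \<sigma> * z, x)"]) measurable
  qed
  also have "\<dots> = (\<integral>\<^sup>+ w. indicator A w \<partial>obs_dist n p \<sigma> \<beta>)"
    by (subst nn_integral_obs_dist) simp_all
  finally show "emeasure (distr (obs_dist n p \<sigma> \<beta>) (obs_dist n p \<sigma> \<beta>) (reflect_obs p \<beta>)) A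
      = emeasure (obs_dist n p \<sigma> \<beta>) A" by simp
qed simp

lemma reflect_data_dist:
  assumes "n > 0"
  shows "distr (data_dist n p \<sigma> \<beta>) (data_dist n p \<sigma> \<beta>) (compose {..<n} (reflect_obs p \<beta>)) = data_dist n p \<sigma> \<beta>"
  unfolding data_dist_def using assms
  by (subst distr_PiM_finite_prob_space')
     (auto simp: reflect_obs_dist intro: prob_space_obs_dist cong: measurable_cong_sets)

text \<open>The loss is averaged over a sample and its reflection, which removes the cross term
  between bias and noise pointwise. Thus only the nonnegative loss of the estimator is integrated,
  and integrability of the cross term is never an issue.\<close>

lemma ridge_risk_le:
  assumes n: "n > 0" and l: "l > 0" and h: "h \<in> ridge_estimators n p l"
  shows "risk n p \<sigma> h \<beta> \<le> ennreal (sqnorm p \<beta> * (1 - 2 / l + 3 * (1 + 3 * real p / real n) / l\<^sup>2) + real p * \<sigma>\<^sup>2 / l\<^sup>2)"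
proof -
  let ?D = "data_dist n p \<sigma> \<beta>"
  define L where "L d = ennreal (sqnorm p (\<lambda>j. h d j - \<beta> j))" for d
  define R where "R = compose {..<n} (reflect_obs p \<beta>)"
  have sp: "space ?D = space (data_space n p)"
    by (rule sets_eq_imp_space_eq) simp
  have he: "h \<in> data_space n p \<rightarrow>\<^sub>M vec_space p"
    using h by (simp add: ridge_estimators_def estimators_def)
  have hj [measurable]: "(\<lambda>d. h d j) \<in> borel_measurable (data_space n p)" if "j < p" for j
    using measurable_compose[OF he measurable_component_singleton, of j] that by simp
  have L [measurable]: "L \<in> borel_measurable (data_space n p)"
    unfolding L_def sqnorm_def by measurable
  have R [measurable]: "R \<in> data_space n p \<rightarrow>\<^sub>M data_space n p"
    unfolding R_def compose_def data_space_def by measurable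
  define B where "B d = sqnorm p \<beta> - 2 * dotp p \<beta> (gramv n p (\<lambda>i. snd (d i)) \<beta>) / l
      + 3 * sqnorm p (gramv n p (\<lambda>i. snd (d i)) \<beta>) / l\<^sup>2
      + sqnorm p (\<lambda>j. \<Sum>i<n. snd (d i) j * (fst (d i) - dotp p (snd (d i)) \<beta>)) / l\<^sup>2" for d :: dataset
  have ptw: "L d + L (R d) \<le> ennreal (2 * B d)" "0 \<le> B d" if d: "d \<in> space (data_space n p)" for d
  proof -
    have Rd: "R d \<in> space (data_space n p)" using d R by (rule measurable_space[rotated])
    have g: "gramv n p (\<lambda>i. snd (R d i)) b j = gramv n p (\<lambda>i. snd (d i)) b j" for b j
      by (simp add: gramv_def R_def compose_def reflect_obs_def)
    have s: "(\<Sum>i<n. snd (R d i) j * fst (R d i)) = (\<Sum>i<n. snd (d i) j * (2 * dotp p (snd (d i)) \<beta> - fst (d i)))" for j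
      by (intro sum.cong refl) (simp add: R_def compose_def reflect_obs_def)
    have "sqnorm p (\<lambda>j. h d j - \<beta> j) + sqnorm p (\<lambda>j. h (R d) j - \<beta> j) \<le> 2 * B d"
      unfolding B_def
    proof (rule ridge_reflected_loss[OF l])
      fix j assume j: "j < p"
      show "gramv n p (\<lambda>i. snd (d i)) (h d) j + l * h d j = (\<Sum>i<n. snd (d i) j * fst (d i))"
        using h d j unfolding ridge_estimators_iff[OF l] by blast
      have "gramv n p (\<lambda>i. snd (R d i)) (h (R d)) j + l * h (R d) j = (\<Sum>i<n. snd (R d i) j * fst (R d i))"
        using h Rd j unfolding ridge_estimators_iff[OF l] by blast
      then show "gramv n p (\<lambda>i. snd (d i)) (h (R d)) j + l * h (R d) j
          = (\<Sum>i<n. snd (d i) j * (2 * dotp p (snd (d i)) \<beta> - fst (d i)))"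
        unfolding g s .
    qed
    note le = this
    then show "L d + L (R d) \<le> ennreal (2 * B d)"
      unfolding L_def by (simp add: ennreal_leI flip: ennreal_plus)
    \<comment> \<open>The sign of \<open>B\<close> is inherited from the two squared norms that
      \<open>2 * B d\<close> dominates.\<close>
    have "0 \<le> 2 * B d"
      by (rule order_trans[OF add_nonneg_nonneg le]) simp_all
    then show "0 \<le> B d" by simp
  qed
  obtain I2 where I2: "I2 \<le> sqnorm p \<beta> * (1 + 3 * real p / real n)"
     "has_bochner_integral ?D (\<lambda>d. sqnorm p (gramv n p (\<lambda>i. snd (d i)) \<beta>)) I2"
    using gram_moments(2)[OF n, of p \<beta> \<sigma>] by blast
  obtain I3 where I3: "I3 \<le> real p * \<sigma>\<^sup>2" "has_bochner_integral ?D
      (\<lambda>d. sqnorm p (\<lambda>j. \<Sum>i<n. snd (d i) j * (fst (d i) - dotp p (snd (d i)) \<beta>))) I3"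
    using gram_moments(3)[OF n, of p \<sigma> \<beta>] by blast
  interpret D: prob_space ?D using n by (rule prob_space_data_dist)
  have "has_bochner_integral ?D (\<lambda>_. sqnorm p \<beta>) (sqnorm p \<beta>)"
    by (simp add: has_bochner_integral_iff D.prob_space)
  then have intB: "has_bochner_integral ?D B (sqnorm p \<beta> - 2 * sqnorm p \<beta> / l + 3 * I2 / l\<^sup>2 + I3 / l\<^sup>2)"
    unfolding B_def[abs_def] times_divide_eq_right[symmetric]
    using gram_moments(1)[OF n, of p \<sigma> \<beta>] I2(2) I3(2)
    by (intro has_bochner_integral_add has_bochner_integral_diff has_bochner_integral_mult_right
        has_bochner_integral_divide_zero) simp_all
  have "risk n p \<sigma> h \<beta> = (\<integral>\<^sup>+ d. L d \<partial>?D)"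
    by (simp add: risk_def L_def)
  moreover have "(\<integral>\<^sup>+ d. L (R d) \<partial>?D) = (\<integral>\<^sup>+ d. L d \<partial>?D)"
  proof -
    have "(\<integral>\<^sup>+ d. L d \<partial>?D) = (\<integral>\<^sup>+ d. L d \<partial>distr ?D ?D R)"
      unfolding R_def reflect_data_dist[OF n] ..
    also have "\<dots> = (\<integral>\<^sup>+ d. L (R d) \<partial>?D)"
      by (rule nn_integral_distr) (simp_all cong: measurable_cong_sets)
    finally show ?thesis ..
  qed
  ultimately have "2 * risk n p \<sigma> h \<beta> = (\<integral>\<^sup>+ d. L d + L (R d) \<partial>?D)"
    by (subst nn_integral_add) (simp_all add: mult_2 cong: measurable_cong_sets)
  also have "\<dots> \<le> (\<integral>\<^sup>+ d. ennreal (2 * B d) \<partial>?D)"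
    using ptw sp by (intro nn_integral_mono) simp
  also have "\<dots> = ennreal (\<integral>d. 2 * B d \<partial>?D)"
    using intB ptw sp
    by (intro nn_integral_eq_integral) (auto simp: has_bochner_integral_iff intro!: AE_I2)
  also have "\<dots> = 2 * ennreal (\<integral>d. B d \<partial>?D)"
    by (subst integral_mult_right_zero, subst ennreal_mult'') (auto intro!: integral_nonneg_AE AE_I2 simp: ptw sp)
  finally have "risk n p \<sigma> h \<beta> \<le> ennreal (\<integral>d. B d \<partial>?D)"
    by (subst (asm) ennreal_mult_le_mult_iff) auto
  also have "(\<integral>d. B d \<partial>?D) = sqnorm p \<beta> - 2 * sqnorm p \<beta> / l + 3 * I2 / l\<^sup>2 + I3 / l\<^sup>2"
    using intB by (simp add: has_bochner_integral_iff)
  also have "\<dots> \<le> sqnorm p \<beta> - 2 * sqnorm p \<beta> / l + 3 * (sqnorm p \<beta> * (1 + 3 * real p / real n)) / l\<^sup>2 + real p * \<sigma>\<^sup>2 / l\<^sup>2"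
    using I2(1) I3(1) by (intro add_mono divide_right_mono order_refl) auto
  also have "\<dots> = sqnorm p \<beta> * (1 - 2 / l + 3 * (1 + 3 * real p / real n) / l\<^sup>2) + real p * \<sigma>\<^sup>2 / l\<^sup>2"
    by (simp add: algebra_simps)
  finally show ?thesis using ennreal_leI by (simp add: )
qed

lemma ridge_worst_case_le:
  fixes M :: real
  assumes n: "n > 0" and pos: "p > 0" "k > 0" "\<sigma> > 0" "\<tau> > 0"
    and M: "M = real k * \<tau>\<^sup>2" and l: "l = real p * \<sigma>\<^sup>2 / M" and h: "h \<in> ridge_estimators n p l"
  shows "worst_case_risk n p k \<tau> \<sigma> h \<le> ennreal (M * (1 - 1 / l + (3 + 9 * real p / real n) / l\<^sup>2))"
  unfolding worst_case_risk_def
proof (rule SUP_least)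
  fix \<beta> assume "\<beta> \<in> Theta p k \<tau>"
  then have b: "sqnorm p \<beta> \<le> M" by (simp add: Theta_def M)
  have M0: "M > 0" using pos by (simp add: M)
  have l0: "l > 0" using pos M0 by (simp add: l)
  define c where "c = 1 - 2 / l + 3 * (1 + 3 * real p / real n) / l\<^sup>2"
  \<comment> \<open>Nonnegativity of \<open>c\<close> is what allows the energy of
    \<open>\<beta>\<close> to be replaced by its maximum \<open>M\<close>; completing the square
    gives it for every \<open>l > 0\<close>.\<close>
  have "c = (1 - 1 / l)\<^sup>2 + (2 + 9 * real p / real n) / l\<^sup>2"
    using l0 by (simp add: c_def power2_diff power_divide add_divide_distrib)
  also have "\<dots> \<ge> 0" using n l0 by simp
  finally have c: "c \<ge> 0" .
  \<comment> \<open>The tuning at work: the variance bound becomes \<open>M / l\<close>, half of the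
    gain \<open>2 * M / l\<close> in the bias.\<close>
  have ps: "real p * \<sigma>\<^sup>2 = M * l" using M0 by (simp add: l)
  have "sqnorm p \<beta> * c + real p * \<sigma>\<^sup>2 / l\<^sup>2 \<le> M * c + real p * \<sigma>\<^sup>2 / l\<^sup>2"
    using b c by (simp add: mult_right_mono)
  also have "\<dots> = M * (1 - 1 / l + (3 + 9 * real p / real n) / l\<^sup>2)"
    using l0 unfolding ps by (simp add: c_def power2_eq_square field_simps)
  finally show "risk n p \<sigma> h \<beta> \<le> ennreal (M * (1 - 1 / l + (3 + 9 * real p / real n) / l\<^sup>2))"
    using ridge_risk_le[OF n l0 h, of \<sigma> \<beta>] unfolding c_def by (meson ennreal_leI order_trans)
qed

section \<open>Likelihood ratios\<close>

text \<open>Both measures agree on boxes, where the integral of a product of one-coordinate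
  functions factors, and boxes determine a finite product measure.\<close>

lemma PiM_density:
  assumes I: "finite I" and N: "prob_space N" and f [measurable]: "f \<in> borel_measurable N"
    and Nf: "prob_space (density N f)"
  shows "(\<Pi>\<^sub>M i\<in>I. density N f) = density (\<Pi>\<^sub>M i\<in>I. N) (\<lambda>d. \<Prod>i\<in>I. f (d i))"
proof -
  interpret N: prob_space N by fact
  interpret P: product_prob_space "\<lambda>_. N" ..
  interpret Nf: prob_space "density N f" by fact
  interpret Pf: product_prob_space "\<lambda>_. density N f" ..
  show ?thesis
  proof (rule Pf.PiM_eqI[OF I, symmetric])
    show "sets (density (\<Pi>\<^sub>M i\<in>I. N) (\<lambda>d. \<Prod>i\<in>I. f (d i))) = sets (\<Pi>\<^sub>M i\<in>I. density N f)"
      by (simp, intro sets_PiM_cong) auto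
  next
    fix A assume "\<And>i. i \<in> I \<Longrightarrow> A i \<in> sets (density N f)"
    then have A: "A i \<in> sets N" if "i \<in> I" for i using that by simp
    then have [measurable]: "Pi\<^sub>E I A \<in> sets (\<Pi>\<^sub>M i\<in>I. N)"
      using I by (intro sets_PiM_I_finite) auto
    have "emeasure (density (\<Pi>\<^sub>M i\<in>I. N) (\<lambda>d. \<Prod>i\<in>I. f (d i))) (Pi\<^sub>E I A)
        = (\<integral>\<^sup>+ d. (\<Prod>i\<in>I. f (d i)) * indicator (Pi\<^sub>E I A) d \<partial>(\<Pi>\<^sub>M i\<in>I. N))"
      by (subst emeasure_density) simp_all
    also have "\<dots> = (\<integral>\<^sup>+ d. (\<Prod>i\<in>I. f (d i) * indicator (A i) (d i)) \<partial>(\<Pi>\<^sub>M i\<in>I. N))"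
    proof (rule nn_integral_cong)
      fix d assume d: "d \<in> space (\<Pi>\<^sub>M i\<in>I. N)"
      have "(indicator (Pi\<^sub>E I A) d :: ennreal) = (\<Prod>i\<in>I. indicator (A i) (d i))"
      proof (cases "d \<in> Pi\<^sub>E I A")
        case True
        then have "(\<Prod>i\<in>I. indicator (A i) (d i) :: ennreal) = 1"
          by (intro prod.neutral) (auto simp: PiE_iff)
        with True show ?thesis by simp
      next
        case False
        with d obtain i where "i \<in> I" "d i \<notin> A i" by (auto simp: space_PiM PiE_iff)
        then have "(\<Prod>i\<in>I. indicator (A i) (d i) :: ennreal) = 0"
          using I by (intro prod_zero) (auto intro!: bexI[of _ i])
        with False show ?thesis by simp
      qed
      then show "(\<Prod>i\<in>I. f (d i)) * indicator (Pi\<^sub>E I A) d = (\<Prod>i\<in>I. f (d i) * indicator (A i) (d i))"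
        by (simp add: prod.distrib)
    qed
    also have "\<dots> = (\<Prod>i\<in>I. \<integral>\<^sup>+ w. f w * indicator (A i) w \<partial>N)"
    proof (rule P.product_nn_integral_prod[OF I])
      fix i assume "i \<in> I"
      from A[OF this] show "(\<lambda>w. f w * indicator (A i) w) \<in> borel_measurable N" by simp
    qed
    also have "\<dots> = (\<Prod>i\<in>I. emeasure (density N f) (A i))"
      using A by (intro prod.cong refl) (simp add: emeasure_density)
    finally show "emeasure (density (\<Pi>\<^sub>M i\<in>I. N) (\<lambda>d. \<Prod>i\<in>I. f (d i))) (Pi\<^sub>E I A)
        = (\<Prod>i\<in>I. emeasure (density N f) (A i))" .
  qed
qed

text \<open>Given \<open>x\<close>, passing from \<open>\<beta>\<close> to \<open>\<beta>'\<close>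
  shifts the standardised noise by the difference of the two linear predictors over
  \<open>\<sigma>\<close>. The law of \<open>x\<close> is common to both, so only the shift density
  remains.\<close>

lemma obs_dist_density:
  assumes s: "\<sigma> > 0"
  shows "obs_dist n p \<sigma> \<beta>' = density (obs_dist n p \<sigma> \<beta>)
    (\<lambda>w. ennreal (exp ((dotp p (snd w) \<beta>' - dotp p (snd w) \<beta>) / \<sigma> * ((fst w - dotp p (snd w) \<beta>) / \<sigma>)
        - ((dotp p (snd w) \<beta>' - dotp p (snd w) \<beta>) / \<sigma>)\<^sup>2 / 2)))"
    (is "_ = density _ ?L")
proof (rule measure_eqI)
  fix A assume "A \<in> sets (obs_dist n p \<sigma> \<beta>')"
  then have A [measurable]: "A \<in> sets (borel \<Otimes>\<^sub>M vec_space p)" by simp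
  have "emeasure (obs_dist n p \<sigma> \<beta>') A = (\<integral>\<^sup>+ w. indicator A w \<partial>obs_dist n p \<sigma> \<beta>')" by simp
  also have "\<dots> = (\<integral>\<^sup>+ x. \<integral>\<^sup>+ z. indicator A (dotp p x \<beta>' + \<sigma> * z, x) \<partial>noise_dist \<partial>design_dist n p)"
    by (subst nn_integral_obs_dist) simp_all
  also have "\<dots> = (\<integral>\<^sup>+ x. \<integral>\<^sup>+ z. ?L (dotp p x \<beta> + \<sigma> * z, x) * indicator A (dotp p x \<beta> + \<sigma> * z, x) \<partial>noise_dist \<partial>design_dist n p)"
  proof (rule nn_integral_cong)
    fix x assume "x \<in> space (design_dist n p)"
    then have [measurable]: "x \<in> space (vec_space p)"
      using sets_eq_imp_space_eq[OF sets_design_dist] by blast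
    define a where "a = (dotp p x \<beta>' - dotp p x \<beta>) / \<sigma>"
    have "dotp p x \<beta>' + \<sigma> * z = dotp p x \<beta> + \<sigma> * (z + a)" for z
      using s by (simp add: a_def field_simps)
    then have "(\<integral>\<^sup>+ z. indicator A (dotp p x \<beta>' + \<sigma> * z, x) \<partial>noise_dist)
       = (\<integral>\<^sup>+ z. indicator A (dotp p x \<beta> + \<sigma> * (z + a), x) \<partial>noise_dist)" by simp
    also have "\<dots> = (\<integral>\<^sup>+ z. ennreal (exp (a * z - a\<^sup>2 / 2)) * indicator A (dotp p x \<beta> + \<sigma> * z, x) \<partial>noise_dist)"
      by (rule nn_integral_noise_dist_shift[of "\<lambda>z. indicator A (dotp p x \<beta> + \<sigma> * z, x)"]) measurable
    finally show "(\<integral>\<^sup>+ z. indicator A (dotp p x \<beta>' + \<sigma> * z, x) \<partial>noise_dist)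
       = (\<integral>\<^sup>+ z. ?L (dotp p x \<beta> + \<sigma> * z, x) * indicator A (dotp p x \<beta> + \<sigma> * z, x) \<partial>noise_dist)"
      using s by (simp add: a_def)
  qed
  also have "\<dots> = (\<integral>\<^sup>+ w. ?L w * indicator A w \<partial>obs_dist n p \<sigma> \<beta>)"
    by (subst nn_integral_obs_dist) simp_all
  also have "\<dots> = emeasure (density (obs_dist n p \<sigma> \<beta>) ?L) A"
    by (subst emeasure_density) simp_all
  finally show "emeasure (obs_dist n p \<sigma> \<beta>') A = emeasure (density (obs_dist n p \<sigma> \<beta>) ?L) A" .
qed simp

lemma measurable_obs_parts [measurable (raw)]:
  "(\<lambda>w. dotp p (snd w) \<beta>) \<in> borel_measurable (borel \<Otimes>\<^sub>M vec_space p)"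
  "j < p \<Longrightarrow> (\<lambda>w. snd w j) \<in> borel_measurable (borel \<Otimes>\<^sub>M vec_space p)"
  using measurable_compose[OF measurable_snd measurable_dotp]
    measurable_compose[OF measurable_snd measurable_component_singleton[of j "{..<p}" "\<lambda>_. borel"]]
  by simp_all

section \<open>Likelihood ratio of a spike and its exponential moments\<close>

definition colsq :: "nat \<Rightarrow> dataset \<Rightarrow> nat \<Rightarrow> real" where
  "colsq n d a = (\<Sum>i<n. (snd (d i) a)\<^sup>2)"

text \<open>Under \<open>data_dist n p \<sigma> \<beta>\<close> this is the j-th column of the
  design paired with the standardised noise. Together with \<open>colsq\<close> it determines the
  likelihood ratio of a spike at \<open>j\<close>.\<close>

definition score :: "nat \<Rightarrow> nat \<Rightarrow> real \<Rightarrow> (nat \<Rightarrow> real) \<Rightarrow> dataset \<Rightarrow> nat \<Rightarrow> real" where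
  "score n p \<sigma> \<beta> d j = (\<Sum>i<n. snd (d i) j * ((fst (d i) - dotp p (snd (d i)) \<beta>) / \<sigma>))"

lemma measurable_colsq [measurable]: "a < p \<Longrightarrow> (\<lambda>d. colsq n d a) \<in> borel_measurable (data_space n p)"
  unfolding colsq_def by measurable

lemma measurable_score [measurable]: "j < p \<Longrightarrow> (\<lambda>d. score n p \<sigma> \<beta> d j) \<in> borel_measurable (data_space n p)"
  unfolding score_def dotp_def by measurable

lemma dotp_update: "j < p \<Longrightarrow> \<beta> j = 0 \<Longrightarrow> dotp p x (\<beta>(j := s)) = dotp p x \<beta> + s * x j"
proof -
  assume j: "j < p" "\<beta> j = 0"
  have "dotp p x (\<beta>(j := s)) = (\<Sum>i<p. x i * \<beta> i + (if i = j then s * x j else 0))"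
    unfolding dotp_def using j by (intro sum.cong) auto
  then show ?thesis using j by (simp add: sum.distrib dotp_def)
qed

text \<open>With the spike height in units of \<open>\<sigma>\<close> the ratio depends on
  \<open>t\<close> alone. The base vector is arbitrary away from \<open>j\<close>, so it can carry
  the spikes of other blocks.\<close>

lemma data_dist_density:
  assumes n: "n > 0" and s: "\<sigma> > 0" and j: "j < p" "\<beta> j = 0"
  shows "data_dist n p \<sigma> (\<beta>(j := t * \<sigma>)) = density (data_dist n p \<sigma> \<beta>)
    (\<lambda>d. ennreal (exp (t * score n p \<sigma> \<beta> d j - t\<^sup>2 / 2 * colsq n d j)))"
proof -
  define f where "f w = ennreal (exp (t * (snd w j * ((fst w - dotp p (snd w) \<beta>) / \<sigma>)) - t\<^sup>2 / 2 * (snd w j)\<^sup>2))"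
    for w :: "real \<times> (nat \<Rightarrow> real)"
  have ob: "obs_dist n p \<sigma> (\<beta>(j := t * \<sigma>)) = density (obs_dist n p \<sigma> \<beta>) f"
    using s j by (subst obs_dist_density[of \<sigma> n p _ \<beta>])
      (auto simp: dotp_update f_def[abs_def] power_mult_distrib mult_ac)
  have [measurable]: "(\<lambda>w. snd w j) \<in> borel_measurable (borel \<Otimes>\<^sub>M vec_space p)"
    "(\<lambda>w. dotp p (snd w) \<beta>) \<in> borel_measurable (borel \<Otimes>\<^sub>M vec_space p)"
    using j measurable_obs_parts by auto
  have "f \<in> borel_measurable (borel \<Otimes>\<^sub>M vec_space p)"
    unfolding f_def by measurable
  then have [measurable]: "f \<in> borel_measurable (obs_dist n p \<sigma> \<beta>)"
    by (simp cong: measurable_cong_sets)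
  have "data_dist n p \<sigma> (\<beta>(j := t * \<sigma>)) = density (data_dist n p \<sigma> \<beta>) (\<lambda>d. \<Prod>i<n. f (d i))"
    unfolding data_dist_def ob
    by (rule PiM_density) (use n in \<open>auto intro: prob_space_obs_dist simp flip: ob\<close>)
  also have "(\<lambda>d. \<Prod>i<n. f (d i)) = (\<lambda>d. ennreal (exp (t * score n p \<sigma> \<beta> d j - t\<^sup>2 / 2 * colsq n d j)))"
    unfolding f_def
    by (subst prod_ennreal, simp)
       (simp add: score_def colsq_def sum_distrib_left sum_subtractf flip: exp_sum)
  finally show ?thesis .
qed

text \<open>Integrating out the noise of one row turns the score term into an extra
  \<open>\<theta>\<^sup>2 / 2\<close> on coordinate \<open>j\<close> of a quadratic form in
  \<open>x\<close>, whence \<open>C\<close>. The coordinates then separate, and the \<open>n\<close>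
  independent rows give the power.\<close>

lemma nn_integral_data_exp:
  assumes n: "n > 0" and s: "\<sigma> > 0" and j: "j < p"
    and C: "\<And>a. C a = c a + of_bool (a = j) * (\<theta>\<^sup>2 / 2)" and small: "\<And>a. a < p \<Longrightarrow> 2 * C a < real n"
  shows "(\<integral>\<^sup>+ d. ennreal (exp ((\<Sum>a<p. c a * colsq n d a) + \<theta> * score n p \<sigma> \<beta> d j)) \<partial>data_dist n p \<sigma> \<beta>)
    = ennreal ((\<Prod>a<p. 1 / sqrt (1 - 2 * C a / real n)) ^ n)"
proof -
  interpret O: prob_space "obs_dist n p \<sigma> \<beta>" using n by (rule prob_space_obs_dist)
  interpret PO: product_prob_space "\<lambda>_::nat. obs_dist n p \<sigma> \<beta>" ..
  interpret K: prob_space "coord_dist n" using n by (rule prob_space_coord_dist)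
  interpret PK: product_prob_space "\<lambda>_::nat. coord_dist n" ..
  define f where "f w = ennreal (exp ((\<Sum>a<p. c a * (snd w a)\<^sup>2) + \<theta> * (snd w j * ((fst w - dotp p (snd w) \<beta>) / \<sigma>))))"
    for w :: "real \<times> (nat \<Rightarrow> real)"
  have [measurable]: "(\<lambda>w. snd w a) \<in> borel_measurable (borel \<Otimes>\<^sub>M vec_space p)" if "a < p" for a
    using that by (rule measurable_obs_parts)
  have [measurable]: "(\<lambda>w. snd w j) \<in> borel_measurable (borel \<Otimes>\<^sub>M vec_space p)"
    "(\<lambda>w. dotp p (snd w) \<beta>) \<in> borel_measurable (borel \<Otimes>\<^sub>M vec_space p)"
    using j measurable_obs_parts by auto
  have fm [measurable]: "f \<in> borel_measurable (borel \<Otimes>\<^sub>M vec_space p)"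
    unfolding f_def by measurable
  have "exp ((\<Sum>a<p. c a * colsq n d a) + \<theta> * score n p \<sigma> \<beta> d j)
     = (\<Prod>i<n. exp ((\<Sum>a<p. c a * (snd (d i) a)\<^sup>2) + \<theta> * (snd (d i) j * ((fst (d i) - dotp p (snd (d i)) \<beta>) / \<sigma>))))" for d
  proof -
    have "(\<Sum>a<p. c a * colsq n d a) = (\<Sum>i<n. \<Sum>a<p. c a * (snd (d i) a)\<^sup>2)"
      unfolding colsq_def sum_distrib_left by (rule sum.swap)
    then show ?thesis by (simp add: score_def sum_distrib_left sum.distrib flip: exp_sum)
  qed
  then have "(\<integral>\<^sup>+ d. ennreal (exp ((\<Sum>a<p. c a * colsq n d a) + \<theta> * score n p \<sigma> \<beta> d j)) \<partial>data_dist n p \<sigma> \<beta>)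
      = (\<integral>\<^sup>+ d. (\<Prod>i<n. f (d i)) \<partial>data_dist n p \<sigma> \<beta>)"
    unfolding f_def by (subst prod_ennreal) auto
  also have "\<dots> = (\<integral>\<^sup>+ w. f w \<partial>obs_dist n p \<sigma> \<beta>) ^ n"
    unfolding data_dist_def by (subst PO.product_nn_integral_prod) (auto cong: measurable_cong_sets)
  also have "(\<integral>\<^sup>+ w. f w \<partial>obs_dist n p \<sigma> \<beta>)
      = (\<integral>\<^sup>+ x. \<integral>\<^sup>+ z. f (dotp p x \<beta> + \<sigma> * z, x) \<partial>noise_dist \<partial>design_dist n p)"
    by (rule nn_integral_obs_dist) measurable
  also have "\<dots> = (\<integral>\<^sup>+ x. (\<Prod>a<p. ennreal (exp (C a * (x a)\<^sup>2))) \<partial>design_dist n p)"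
  proof (rule nn_integral_cong)
    fix x
    have "(\<integral>\<^sup>+ z. f (dotp p x \<beta> + \<sigma> * z, x) \<partial>noise_dist)
       = (\<integral>\<^sup>+ z. ennreal (exp (\<Sum>a<p. c a * (x a)\<^sup>2)) * ennreal (exp ((\<theta> * x j) * z)) \<partial>noise_dist)"
      using s unfolding f_def
      by (intro nn_integral_cong) (simp add: mult_ac flip: ennreal_mult exp_add)
    also have "\<dots> = ennreal (exp (\<Sum>a<p. c a * (x a)\<^sup>2)) * ennreal (exp ((\<theta> * x j)\<^sup>2 / 2))"
      by (subst nn_integral_cmult) (simp_all add: nn_integral_noise_exp)
    also have "\<dots> = ennreal (exp ((\<Sum>a<p. c a * (x a)\<^sup>2) + (\<theta> * x j)\<^sup>2 / 2))"
      by (simp add: exp_add flip: ennreal_mult)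
    also have "(\<theta> * x j)\<^sup>2 / 2 = (\<Sum>a<p. if a = j then \<theta>\<^sup>2 / 2 * (x a)\<^sup>2 else 0)"
      using j by (simp add: power_mult_distrib)
    also have "(\<Sum>a<p. c a * (x a)\<^sup>2) + (\<Sum>a<p. if a = j then \<theta>\<^sup>2 / 2 * (x a)\<^sup>2 else 0) = (\<Sum>a<p. C a * (x a)\<^sup>2)"
      unfolding sum.distrib[symmetric] by (intro sum.cong refl) (simp add: C algebra_simps)
    finally show "(\<integral>\<^sup>+ z. f (dotp p x \<beta> + \<sigma> * z, x) \<partial>noise_dist) = (\<Prod>a<p. ennreal (exp (C a * (x a)\<^sup>2)))"
      by (simp add: exp_sum prod_ennreal)
  qed
  also have "\<dots> = (\<Prod>a<p. \<integral>\<^sup>+ x. ennreal (exp (C a * x\<^sup>2)) \<partial>coord_dist n)"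
    unfolding design_dist_eq by (rule PK.product_nn_integral_prod) auto
  also have "\<dots> = ennreal (\<Prod>a<p. 1 / sqrt (1 - 2 * C a / real n))"
  proof -
    have "0 \<le> 1 / sqrt (1 - 2 * C a / real n)" if "a < p" for a
      using small[OF that] n by simp
    then show ?thesis
      using n small by (subst prod_ennreal[symmetric]) (auto intro!: prod.cong nn_integral_coord_exp_square)
  qed
  also have "ennreal (\<Prod>a<p. 1 / sqrt (1 - 2 * C a / real n)) ^ n = ennreal ((\<Prod>a<p. 1 / sqrt (1 - 2 * C a / real n)) ^ n)"
    using n small by (intro ennreal_power prod_nonneg) (simp add: less_imp_le)
  finally show ?thesis .
qed

text \<open>The bound must not depend on \<open>n\<close>. Nonnegativity puts the numbers
  \<open>2 * C a / n\<close> in the unit interval, so Weierstrass' product inequality applies, and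
  Bernoulli's inequality then absorbs the power \<open>n\<close>.\<close>

lemma gaussian_exp_moment_upper:
  fixes p :: nat
  assumes n: "n > 0" and C: "\<And>a. a < p \<Longrightarrow> C a \<ge> 0" and S: "2 * (\<Sum>a<p. C a) < 1"
  shows "(\<Prod>a<p. 1 / sqrt (1 - 2 * C a / real n)) ^ n \<le> 1 / sqrt (1 - 2 * (\<Sum>a<p. C a))"
proof -
  define S where "S = (\<Sum>a<p. C a)"
  have le: "C a \<le> S" if "a < p" for a
    unfolding S_def using C that by (intro member_le_sum[of a "{..<p}" C]) auto
  have S0: "S \<ge> 0" unfolding S_def using C by (intro sum_nonneg) auto
  have n1: "real n \<ge> 1" using n by simp
  have Sn: "2 * S / real n \<le> 1"
    using S n1 S0 by (simp add: S_def[symmetric] field_simps)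
  have in01: "2 * C a / real n \<in> {0..1}" if "a < p" for a
    using C[OF that] le[OF that] S n1 n by (simp add: S_def[symmetric] field_simps)
  have "1 - 2 * S \<le> (1 + (- (2 * S / real n))) ^ n"
    using Bernoulli_inequality[of "- (2 * S / real n)" n] Sn n by simp
  also have "\<dots> \<le> (\<Prod>a<p. 1 - 2 * C a / real n) ^ n"
  proof (rule power_mono)
    show "1 + - (2 * S / real n) \<le> (\<Prod>a<p. 1 - 2 * C a / real n)"
      using Weierstrass_prod_ineq[of "{..<p}" "\<lambda>a. 2 * C a / real n"] in01
      by (simp add: S_def sum_distrib_left sum_divide_distrib)
    show "0 \<le> 1 + - (2 * S / real n)" using Sn by simp
  qed
  finally have le1: "1 - 2 * S \<le> (\<Prod>a<p. 1 - 2 * C a / real n) ^ n" .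
  have sq: "(\<Prod>a<p. 1 / sqrt (1 - 2 * C a / real n)) ^ n = 1 / sqrt ((\<Prod>a<p. 1 - 2 * C a / real n) ^ n)"
  proof -
    have "sqrt (\<Prod>a<p. 1 - 2 * C a / real n) = (\<Prod>a<p. sqrt (1 - 2 * C a / real n))"
      by (induction p) (simp_all add: real_sqrt_mult)
    then show ?thesis by (simp add: real_sqrt_power prod_dividef power_divide)
  qed
  show ?thesis
    unfolding sq S_def[symmetric] using le1 S
    by (intro divide_left_mono) (auto simp: S_def[symmetric] intro!: mult_pos_pos)
qed

text \<open>Here \<open>C\<close> may take both signs: \<open>1 - x \<le> exp (- x)\<close> bounds
  each factor below by an exponential, \<open>n\<close> cancels in the power, and the last
  exponential is linearised from below.\<close>

lemma gaussian_exp_moment_lower: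
  fixes p :: nat
  assumes n: "n > 0" and small: "\<And>a. a < p \<Longrightarrow> 2 * C a < real n"
  shows "1 + (\<Sum>a<p. C a) \<le> (\<Prod>a<p. 1 / sqrt (1 - 2 * C a / real n)) ^ n"
proof -
  have "exp (C a / real n) \<le> 1 / sqrt (1 - 2 * C a / real n)" if "a < p" for a
  proof -
    have pos: "1 - 2 * C a / real n > 0" using small[OF that] n by simp
    have "1 - 2 * C a / real n \<le> exp (- (2 * C a / real n))"
      using exp_ge_add_one_self[of "- (2 * C a / real n)"] by simp
    also have "\<dots> = (exp (- (C a / real n)))\<^sup>2"
      by (simp flip: exp_double)
    finally have "sqrt (1 - 2 * C a / real n) \<le> exp (- (C a / real n))"
      by (intro real_le_lsqrt) auto
    then show ?thesis using pos by (simp add: exp_minus field_simps)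
  qed
  then have "(\<Prod>a<p. exp (C a / real n)) ^ n \<le> (\<Prod>a<p. 1 / sqrt (1 - 2 * C a / real n)) ^ n"
    by (intro power_mono prod_mono prod_nonneg) auto
  moreover have "(\<Prod>a<p. exp (C a / real n)) ^ n = exp (\<Sum>a<p. C a)"
  proof -
    have "(\<Prod>a<p. exp (C a / real n)) = exp ((\<Sum>a<p. C a) / real n)"
      by (simp add: exp_sum sum_divide_distrib)
    then show ?thesis using n by (simp flip: exp_of_nat_mult)
  qed
  ultimately show ?thesis
    using exp_ge_add_one_self[of "\<Sum>a<p. C a"] by linarith
qed

text \<open>The expanded square consists of exponential moments with score parameters
  \<open>2 * t\<close>, \<open>- 2 * t\<close> and 0. For the first two the exponents sum to
  \<open>t\<^sup>2 / 2 + t\<^sup>2\<close>, the origin of \<open>3 * t\<^sup>2\<close>; for the last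
  to \<open>t\<^sup>2 / 2 - t\<^sup>2\<close>, the origin of \<open>t\<^sup>2 / 2\<close>. For small
  \<open>t\<close> the bound is close to \<open>4 * t\<^sup>2\<close>. The weight at
  \<open>l\<close> comes from the inverse posterior normaliser, and \<open>l = j\<close> is
  included.\<close>

lemma likelihood_difference_moment:
  assumes n: "n > 0" and s: "\<sigma> > 0" and jl: "j < p" "l < p" and small: "3 * t\<^sup>2 < 1"
  shows "(\<integral>\<^sup>+ d. ennreal (exp (t\<^sup>2 / 2 * colsq n d l) *
      (exp (t * score n p \<sigma> \<beta> d j - t\<^sup>2 / 2 * colsq n d j) - exp (- t * score n p \<sigma> \<beta> d j - t\<^sup>2 / 2 * colsq n d j))\<^sup>2)
      \<partial>data_dist n p \<sigma> \<beta>) \<le> ennreal (2 * (1 / sqrt (1 - 3 * t\<^sup>2) - 1 + t\<^sup>2 / 2))"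
proof -
  define c where "c a = of_bool (a = l) * (t\<^sup>2 / 2) - of_bool (a = j) * t\<^sup>2" for a :: nat
  define E where "E \<theta> d = exp ((\<Sum>a<p. c a * colsq n d a) + \<theta> * score n p \<sigma> \<beta> d j)" for \<theta> d
  define V where "V = 1 / sqrt (1 - 3 * t\<^sup>2)"
  have n1: "real n \<ge> 1" using n by simp
  have csum: "(\<Sum>a<p. c a * g a) = t\<^sup>2 / 2 * g l - t\<^sup>2 * g j" for g
  proof -
    have "(\<Sum>a<p. c a * g a) = (\<Sum>a<p. (if a = l then t\<^sup>2 / 2 * g l else 0) - (if a = j then t\<^sup>2 * g j else 0))"
      by (intro sum.cong refl) (auto simp: c_def algebra_simps)
    then show ?thesis using jl by (simp add: sum_subtractf)
  qed
  have [measurable]: "E \<theta> \<in> borel_measurable (data_space n p)" for \<theta>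
    unfolding E_def using jl by measurable
  define X where "X d = exp (t\<^sup>2 / 2 * colsq n d l) *
      (exp (t * score n p \<sigma> \<beta> d j - t\<^sup>2 / 2 * colsq n d j) - exp (- t * score n p \<sigma> \<beta> d j - t\<^sup>2 / 2 * colsq n d j))\<^sup>2" for d
  have [measurable]: "X \<in> borel_measurable (data_space n p)"
    unfolding X_def using jl by measurable
  \<comment> \<open>Kept additive, as the integrals to come are extended nonnegative and cannot be
    subtracted. In the mixed term of the square the scores cancel, which leaves parameter 0.\<close>
  have X: "X d + 2 * E 0 d = E (2 * t) d + E (- 2 * t) d" for d
    unfolding X_def E_def csum power2_diff exp_double[symmetric]
    by (simp add: algebra_simps flip: exp_add)
  have X0: "X d \<ge> 0" for d by (simp add: X_def)
  have small_C: "2 * (of_bool (a = l) * (t\<^sup>2 / 2) + of_bool (a = j) * t\<^sup>2) < real n" for a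
    using small n1 by auto
  have up: "(\<integral>\<^sup>+ d. ennreal (E \<theta> d) \<partial>data_dist n p \<sigma> \<beta>) \<le> ennreal V" if "\<theta>\<^sup>2 = 4 * t\<^sup>2" for \<theta>
  proof -
    define C where "C a = of_bool (a = l) * (t\<^sup>2 / 2) + of_bool (a = j) * t\<^sup>2" for a :: nat
    have "(\<Sum>a<p. C a) = (\<Sum>a<p. (if a = l then t\<^sup>2 / 2 else 0) + (if a = j then t\<^sup>2 else 0))"
      by (intro sum.cong refl) (auto simp: C_def)
    then have S: "2 * (\<Sum>a<p. C a) = 3 * t\<^sup>2" using jl by (simp add: sum.distrib)
    have "(\<integral>\<^sup>+ d. ennreal (E \<theta> d) \<partial>data_dist n p \<sigma> \<beta>) = ennreal ((\<Prod>a<p. 1 / sqrt (1 - 2 * C a / real n)) ^ n)"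
      unfolding E_def using small_C that
      by (intro nn_integral_data_exp n s jl) (auto simp: C_def c_def)
    also have "\<dots> \<le> ennreal V"
      using gaussian_exp_moment_upper[OF n, of p C] S small
      by (intro ennreal_leI) (auto simp: V_def C_def[abs_def])
    finally show ?thesis .
  qed
  have lo: "ennreal (1 - t\<^sup>2 / 2) \<le> (\<integral>\<^sup>+ d. ennreal (E 0 d) \<partial>data_dist n p \<sigma> \<beta>)"
  proof -
    have cn: "2 * c a < real n" for a
    proof -
      have "2 * c a \<le> t\<^sup>2" by (auto simp: c_def)
      then show ?thesis using small n1 by linarith
    qed
    have "(\<Sum>a<p. c a) = - (t\<^sup>2 / 2)" using csum[of "\<lambda>_. 1"] by simp
    then have "1 - t\<^sup>2 / 2 \<le> (\<Prod>a<p. 1 / sqrt (1 - 2 * c a / real n)) ^ n"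
      using gaussian_exp_moment_lower[OF n, of p c] cn by simp
    moreover have "(\<integral>\<^sup>+ d. ennreal (E 0 d) \<partial>data_dist n p \<sigma> \<beta>) = ennreal ((\<Prod>a<p. 1 / sqrt (1 - 2 * c a / real n)) ^ n)"
      unfolding E_def using cn by (intro nn_integral_data_exp n s jl) auto
    ultimately show ?thesis by (simp add: ennreal_leI)
  qed
  have "(\<integral>\<^sup>+ d. ennreal (X d) \<partial>data_dist n p \<sigma> \<beta>) + ennreal (2 * (1 - t\<^sup>2 / 2))
     \<le> (\<integral>\<^sup>+ d. ennreal (X d) \<partial>data_dist n p \<sigma> \<beta>) + 2 * (\<integral>\<^sup>+ d. ennreal (E 0 d) \<partial>data_dist n p \<sigma> \<beta>)"
  proof (rule add_left_mono)
    have "ennreal (2 * (1 - t\<^sup>2 / 2)) = 2 * ennreal (1 - t\<^sup>2 / 2)"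
      using small by (subst ennreal_mult) auto
    then show "ennreal (2 * (1 - t\<^sup>2 / 2)) \<le> 2 * (\<integral>\<^sup>+ d. ennreal (E 0 d) \<partial>data_dist n p \<sigma> \<beta>)"
      using lo by (simp only: mult_left_mono zero_le)
  qed
  also have "\<dots> = (\<integral>\<^sup>+ d. ennreal (X d + 2 * E 0 d) \<partial>data_dist n p \<sigma> \<beta>)"
    using X0 by (simp add: E_def ennreal_plus ennreal_mult nn_integral_add nn_integral_cmult cong: measurable_cong_sets)
  also have "\<dots> = (\<integral>\<^sup>+ d. ennreal (E (2 * t) d) \<partial>data_dist n p \<sigma> \<beta>) + (\<integral>\<^sup>+ d. ennreal (E (- 2 * t) d) \<partial>data_dist n p \<sigma> \<beta>)"
  proof -
    have "0 \<le> E \<theta> d" for \<theta> d by (simp add: E_def)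
    then show ?thesis
      unfolding X by (subst nn_integral_add[symmetric]) (simp_all cong: measurable_cong_sets)
  qed
  also have "\<dots> \<le> ennreal V + ennreal V"
    by (intro add_mono up) (simp_all add: power_mult_distrib)
  also have "\<dots> = ennreal (2 * V)"
    using small by (simp add: V_def flip: ennreal_plus)
  finally have le: "(\<integral>\<^sup>+ d. ennreal (X d) \<partial>data_dist n p \<sigma> \<beta>) + ennreal (2 * (1 - t\<^sup>2 / 2)) \<le> ennreal (2 * V)" .
  have "V \<ge> 1" using small by (simp add: V_def)
  then have a: "0 \<le> 2 * (V - 1 + t\<^sup>2 / 2)" using zero_le_power2[of t] by argo
  have b: "0 \<le> 2 * (1 - t\<^sup>2 / 2)" using small zero_le_power2[of t] by argo
  have "ennreal (2 * V) = ennreal (2 * (V - 1 + t\<^sup>2 / 2)) + ennreal (2 * (1 - t\<^sup>2 / 2))"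
    by (subst ennreal_plus[OF a b, symmetric]) (simp add: algebra_simps)
  with le show ?thesis by (simp add: X_def V_def)
qed

section \<open>Bayes risk of a single spike\<close>

text \<open>Completing the square in \<open>h\<close>; the weight \<open>B\<close> stands for an upper bound of
  \<open>1 / (\<Sum>j\<in>J. L j 1 + L j (-1))\<close>.\<close>

lemma spike_posterior_bound:
  fixes L :: "'a \<Rightarrow> real \<Rightarrow> real" and h :: "'a \<Rightarrow> real"
  assumes J: "finite J" and B: "B \<ge> 0" and BC: "1 \<le> B * (\<Sum>j\<in>J. L j 1 + L j (-1))"
  shows "(\<Sum>j\<in>J. L j 1 + L j (-1)) * \<tau>\<^sup>2 \<le>
    (\<Sum>j\<in>J. \<Sum>s\<in>{1, -1}. L j s * (\<Sum>i\<in>J. (h i - (if i = j then s * \<tau> else 0))\<^sup>2))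
      + \<tau>\<^sup>2 * B * (\<Sum>j\<in>J. (L j 1 - L j (-1))\<^sup>2)"
proof -
  define C where "C = (\<Sum>j\<in>J. L j 1 + L j (-1))"
  define N where "N j = L j 1 - L j (-1)" for j
  define H where "H = (\<Sum>i\<in>J. (h i)\<^sup>2)"
  have C: "C > 0"
    using B BC unfolding C_def[symmetric] by (metis less_le_not_le linorder_not_le mult_nonneg_nonpos not_one_le_zero order_trans)
  have sq: "(\<Sum>i\<in>J. (h i - (if i = j then u else 0))\<^sup>2) = H - 2 * u * h j + u\<^sup>2" if "j \<in> J" for j u
  proof -
    have "(\<Sum>i\<in>J. (h i - (if i = j then u else 0))\<^sup>2) = (\<Sum>i\<in>J. (h i)\<^sup>2 + (if i = j then u\<^sup>2 - 2 * u * h j else 0))"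
      by (intro sum.cong refl) (simp add: power2_diff)
    then show ?thesis using J that by (simp add: sum.distrib H_def)
  qed
  have "(\<Sum>j\<in>J. \<Sum>s\<in>{1, -1}. L j s * (\<Sum>i\<in>J. (h i - (if i = j then s * \<tau> else 0))\<^sup>2))
      = (\<Sum>j\<in>J. (L j 1 + L j (-1)) * (H + \<tau>\<^sup>2) - 2 * \<tau> * (h j * N j))"
    by (intro sum.cong refl) (simp add: sq N_def algebra_simps)
  also have "\<dots> = C * (H + \<tau>\<^sup>2) - (\<Sum>j\<in>J. 2 * \<tau> * (h j * N j))"
    by (simp add: sum_subtractf C_def sum_distrib_right)
  also have "\<dots> = C * \<tau>\<^sup>2 + (\<Sum>j\<in>J. C * (h j)\<^sup>2 - 2 * \<tau> * (h j * N j))"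
    by (simp add: sum_subtractf H_def sum_distrib_left distrib_left)
  finally have eq: "(\<Sum>j\<in>J. \<Sum>s\<in>{1, -1}. L j s * (\<Sum>i\<in>J. (h i - (if i = j then s * \<tau> else 0))\<^sup>2))
      = C * \<tau>\<^sup>2 + (\<Sum>j\<in>J. C * (h j)\<^sup>2 - 2 * \<tau> * (h j * N j))" .
  have "0 \<le> C * (h j)\<^sup>2 - 2 * \<tau> * (h j * N j) + \<tau>\<^sup>2 * B * (N j)\<^sup>2" for j
  proof -
    have "C * (C * (h j)\<^sup>2 - 2 * \<tau> * (h j * N j) + \<tau>\<^sup>2 * B * (N j)\<^sup>2)
        = (C * h j - \<tau> * N j)\<^sup>2 + (\<tau> * N j)\<^sup>2 * (B * C - 1)"
      by (simp add: power2_eq_square algebra_simps)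
    also have "\<dots> \<ge> 0" using BC by (simp add: C_def)
    finally show ?thesis using C by (simp add: zero_le_mult_iff)
  qed
  then have "0 \<le> (\<Sum>j\<in>J. C * (h j)\<^sup>2 - 2 * \<tau> * (h j * N j) + \<tau>\<^sup>2 * B * (N j)\<^sup>2)"
    by (intro sum_nonneg)
  also have "\<dots> = (\<Sum>j\<in>J. C * (h j)\<^sup>2 - 2 * \<tau> * (h j * N j)) + \<tau>\<^sup>2 * B * (\<Sum>j\<in>J. (N j)\<^sup>2)"
    by (simp add: sum.distrib sum_distrib_left)
  finally show ?thesis
    unfolding eq C_def[symmetric] N_def by linarith
qed

text \<open>All \<open>2 * card J\<close> spiked laws are referred to the law of
  \<open>\<beta>\<close> by likelihood ratios, and the inequality is pointwise in the data for every
  value of the estimator, so no posterior mean is formed. As \<open>\<beta>\<close> is arbitrary off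
  \<open>J\<close>, the other blocks count as known. After division by \<open>2 * card J\<close> the
  error term is about \<open>t\<^sup>2 * \<tau>\<^sup>2 / card J\<close>.\<close>

lemma spike_block_bayes_risk:
  fixes t :: real
  assumes n: "n > 0" and s: "\<sigma> > 0" and J: "J \<subseteq> {..<p}" "J \<noteq> {}" and b: "\<And>j. j \<in> J \<Longrightarrow> \<beta> j = 0"
    and h: "h \<in> estimators n p" and small: "3 * t\<^sup>2 < 1"
  defines "\<tau> \<equiv> t * \<sigma>"
  shows "ennreal (2 * real (card J) * \<tau>\<^sup>2) \<le>
    (\<Sum>j\<in>J. \<Sum>s\<in>{1, -1}. \<integral>\<^sup>+ d. ennreal (\<Sum>i\<in>J. (h d i - (\<beta>(j := s * \<tau>)) i)\<^sup>2)
        \<partial>data_dist n p \<sigma> (\<beta>(j := s * \<tau>)))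
    + ennreal (\<tau>\<^sup>2 * (1 / sqrt (1 - 3 * t\<^sup>2) - 1 + t\<^sup>2 / 2))"
proof -
  let ?D = "data_dist n p \<sigma> \<beta>"
  have finJ: "finite J" using J by (auto intro: finite_subset)
  define m where "m = real (card J)"
  have m: "m > 0" using finJ J by (simp add: m_def card_gt_0_iff)
  define V where "V = 1 / sqrt (1 - 3 * t\<^sup>2) - 1 + t\<^sup>2 / 2"
  define L where "L d j s = exp (s * t * score n p \<sigma> \<beta> d j - t\<^sup>2 / 2 * colsq n d j)" for d j s
  define A where "A d l = exp (t\<^sup>2 / 2 * colsq n d l)" for d l
  define Q where "Q d j s = (\<Sum>i\<in>J. (h d i - (if i = j then s * \<tau> else 0))\<^sup>2)" for d j s
  define X where "X d j l = A d l * (L d j 1 - L d j (-1))\<^sup>2" for d j l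
  have hm [measurable]: "(\<lambda>d. h d j) \<in> borel_measurable (data_space n p)" if "j \<in> J" for j
    using measurable_compose[OF _ measurable_component_singleton, of h "data_space n p" "{..<p}" "\<lambda>_. borel" j] h J that
    by (auto simp: estimators_def)
  have colm [measurable]: "(\<lambda>d. colsq n d j) \<in> borel_measurable (data_space n p)"
      "(\<lambda>d. score n p \<sigma> \<beta> d j) \<in> borel_measurable (data_space n p)" if "j \<in> J" for j
    using that J by (auto intro!: measurable_colsq measurable_score)
  have Lm [measurable]: "(\<lambda>d. L d j s) \<in> borel_measurable (data_space n p)" if "j \<in> J" for j s
    unfolding L_def using that by measurable
  have Am [measurable]: "(\<lambda>d. A d j) \<in> borel_measurable (data_space n p)" if "j \<in> J" for j
    unfolding A_def using that by measurable
  have Qm [measurable]: "(\<lambda>d. Q d j s) \<in> borel_measurable (data_space n p)" if "j \<in> J" for j s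
    unfolding Q_def by measurable
  have Xm [measurable]: "(\<lambda>d. X d j l) \<in> borel_measurable (data_space n p)" if "j \<in> J" "l \<in> J" for j l
    unfolding X_def using that by measurable
  have pos: "L d j s \<ge> 0" "Q d j s \<ge> 0" "X d j l \<ge> 0" "A d l \<ge> 0" for d j s l
    by (simp_all add: L_def Q_def X_def A_def sum_nonneg)
  have dens: "data_dist n p \<sigma> (\<beta>(j := s * \<tau>)) = density ?D (\<lambda>d. ennreal (L d j s))"
    if "j \<in> J" "s \<in> {1, -1}" for j s
    using data_dist_density[OF n s, of j p \<beta> "s * t"] that J b
    by (auto simp: L_def \<tau>_def mult.assoc power_mult_distrib)
  have one: "(\<integral>\<^sup>+ d. ennreal (L d j s) \<partial>?D) = 1" if "j \<in> J" "s \<in> {1, -1}" for j s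
  proof -
    interpret P: prob_space "data_dist n p \<sigma> (\<beta>(j := s * \<tau>))" using n by (rule prob_space_data_dist)
    have "emeasure (density ?D (\<lambda>d. ennreal (L d j s))) (space ?D) = (\<integral>\<^sup>+ d. ennreal (L d j s) * indicator (space ?D) d \<partial>?D)"
      using Lm[OF that(1), of s] by (intro emeasure_density sets.top) (simp cong: measurable_cong_sets)
    also have "\<dots> = (\<integral>\<^sup>+ d. ennreal (L d j s) \<partial>?D)"
      by (intro nn_integral_cong) simp
    finally show ?thesis
      using P.emeasure_space_1 unfolding dens[OF that] by simp
  qed
  have ri: "(\<integral>\<^sup>+ d. ennreal (\<Sum>i\<in>J. (h d i - (\<beta>(j := s * \<tau>)) i)\<^sup>2) \<partial>data_dist n p \<sigma> (\<beta>(j := s * \<tau>)))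
      = (\<integral>\<^sup>+ d. ennreal (L d j s * Q d j s) \<partial>?D)" if "j \<in> J" "s \<in> {1, -1}" for j s
  proof -
    have "(\<Sum>i\<in>J. (h d i - (\<beta>(j := s * \<tau>)) i)\<^sup>2) = Q d j s" for d
      unfolding Q_def using b by (intro sum.cong refl) auto
    then show ?thesis
      unfolding dens[OF that] using that pos
      by (simp add: nn_integral_density ennreal_mult cong: measurable_cong_sets)
  qed
  have ptw: "(\<Sum>j\<in>J. L d j 1 + L d j (-1)) * \<tau>\<^sup>2 \<le> (\<Sum>j\<in>J. \<Sum>s\<in>{1, -1}. L d j s * Q d j s)
       + \<tau>\<^sup>2 / (2 * m\<^sup>2) * (\<Sum>j\<in>J. \<Sum>l\<in>J. X d j l)" for d
  proof -
    \<comment> \<open>By Cauchy--Schwarz \<open>m\<^sup>2 / (\<Sum>l\<in>J. A d l)\<close> bounds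
      the sum of the \<open>1 / A d l\<close> from below, and each pair of signs contributes at
      least \<open>2 / A d l\<close>. Unlike the true inverse of the normaliser, \<open>B\<close>
      times the squared differences has explicit Gaussian integrals.\<close>
    define B where "B = (\<Sum>l\<in>J. A d l) / (2 * m\<^sup>2)"
    have "m\<^sup>2 = (\<Sum>l\<in>J. sqrt (A d l) * (1 / sqrt (A d l)))\<^sup>2"
      by (simp add: A_def m_def)
    also have "\<dots> \<le> (\<Sum>l\<in>J. (sqrt (A d l))\<^sup>2) * (\<Sum>l\<in>J. (1 / sqrt (A d l))\<^sup>2)"
      by (rule Cauchy_Schwarz_ineq_sum)
    also have "\<dots> = (\<Sum>l\<in>J. A d l) * (\<Sum>l\<in>J. 1 / A d l)"
      using pos by (simp add: power_divide)
    finally have cs: "m\<^sup>2 \<le> (\<Sum>l\<in>J. A d l) * (\<Sum>l\<in>J. 1 / A d l)" .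
    \<comment> \<open>The two signs combine to a hyperbolic cosine of the score times
      \<open>2 / A d j\<close>, and the cosine is at least 1.\<close>
    have "2 / A d j \<le> L d j 1 + L d j (-1)" for j
    proof -
      have "2 \<le> exp u + exp (- u)" for u :: real
        using cosh_real_ge_1[of u] by (simp add: cosh_def)
      then have "1 / A d j * 2 \<le> 1 / A d j * (exp (t * score n p \<sigma> \<beta> d j) + exp (- (t * score n p \<sigma> \<beta> d j)))"
        using pos(4) by (intro mult_left_mono) auto
      also have "\<dots> = L d j 1 + L d j (-1)"
      proof -
        have "L d j s = exp (s * t * score n p \<sigma> \<beta> d j) / A d j" for s
          unfolding L_def A_def by (rule exp_diff)
        then show ?thesis by (simp add: add_divide_distrib)
      qed
      finally show ?thesis by simp
    qed
    then have "2 * (\<Sum>l\<in>J. 1 / A d l) \<le> (\<Sum>j\<in>J. L d j 1 + L d j (-1))"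
      unfolding sum_distrib_left by (intro sum_mono) simp
    then have "(\<Sum>l\<in>J. A d l) * (2 * (\<Sum>l\<in>J. 1 / A d l)) \<le> (\<Sum>l\<in>J. A d l) * (\<Sum>j\<in>J. L d j 1 + L d j (-1))"
      using pos by (intro mult_left_mono sum_nonneg) auto
    with cs have "2 * m\<^sup>2 \<le> (\<Sum>l\<in>J. A d l) * (\<Sum>j\<in>J. L d j 1 + L d j (-1))" by simp
    then have BC: "1 \<le> B * (\<Sum>j\<in>J. L d j 1 + L d j (-1))"
      using m by (simp add: B_def field_simps)
    have B0: "B \<ge> 0" using pos by (simp add: B_def sum_nonneg)
    have "\<tau>\<^sup>2 * B * (\<Sum>j\<in>J. (L d j 1 - L d j (-1))\<^sup>2) = \<tau>\<^sup>2 / (2 * m\<^sup>2) * (\<Sum>j\<in>J. \<Sum>l\<in>J. X d j l)"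
    proof -
      have "(\<Sum>l\<in>J. A d l) * (\<Sum>j\<in>J. (L d j 1 - L d j (-1))\<^sup>2) = (\<Sum>j\<in>J. \<Sum>l\<in>J. X d j l)"
        unfolding X_def sum_product by (rule sum.swap)
      then show ?thesis unfolding B_def by (metis (no_types, lifting) mult.assoc times_divide_eq_left times_divide_eq_right)
    qed
    then show ?thesis
      using spike_posterior_bound[OF finJ B0 BC, of \<tau> "h d"] unfolding Q_def by simp
  qed
  have XV: "(\<integral>\<^sup>+ d. ennreal (X d j l) \<partial>?D) \<le> ennreal (2 * V)" if "j \<in> J" "l \<in> J" for j l
    using likelihood_difference_moment[OF n s, of j p l t \<beta>] that J small
    by (auto simp: X_def A_def L_def V_def)
  have V0: "V \<ge> 0" using small by (simp add: V_def)

  have "ennreal (2 * m * \<tau>\<^sup>2) = (\<Sum>j\<in>J. \<Sum>s\<in>{1, -1}. \<integral>\<^sup>+ d. ennreal (L d j s) \<partial>?D) * ennreal (\<tau>\<^sup>2)"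
    using one by (simp add: m_def mult.commute flip: ennreal_of_nat_eq_real_of_nat ennreal_mult ennreal_plus)
      (simp add: ennreal_mult ennreal_of_nat_eq_real_of_nat mult_2 distrib_left)
  also have "\<dots> = (\<integral>\<^sup>+ d. ennreal ((\<Sum>j\<in>J. L d j 1 + L d j (-1)) * \<tau>\<^sup>2) \<partial>?D)"
  proof -
    have "(\<integral>\<^sup>+ d. ennreal ((\<Sum>j\<in>J. L d j 1 + L d j (-1)) * \<tau>\<^sup>2) \<partial>?D)
       = (\<integral>\<^sup>+ d. (\<Sum>j\<in>J. \<Sum>s\<in>{1, -1}. ennreal (L d j s)) * ennreal (\<tau>\<^sup>2) \<partial>?D)"
      using pos by (intro nn_integral_cong) (simp add: ennreal_mult sum_nonneg flip: ennreal_plus)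
    also have "\<dots> = (\<integral>\<^sup>+ d. (\<Sum>j\<in>J. \<Sum>s\<in>{1, -1}. ennreal (L d j s)) \<partial>?D) * ennreal (\<tau>\<^sup>2)"
      by (intro nn_integral_multc borel_measurable_sum) (auto cong: measurable_cong_sets)
    also have "(\<integral>\<^sup>+ d. (\<Sum>j\<in>J. \<Sum>s\<in>{1, -1}. ennreal (L d j s)) \<partial>?D) = (\<Sum>j\<in>J. \<Sum>s\<in>{1, -1}. \<integral>\<^sup>+ d. ennreal (L d j s) \<partial>?D)"
      by (subst nn_integral_sum) (auto intro!: sum.cong nn_integral_sum nn_integral_add cong: measurable_cong_sets)
    finally show ?thesis by simp
  qed
  also have "\<dots> \<le> (\<integral>\<^sup>+ d. ennreal ((\<Sum>j\<in>J. \<Sum>s\<in>{1, -1}. L d j s * Q d j s)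
       + \<tau>\<^sup>2 / (2 * m\<^sup>2) * (\<Sum>j\<in>J. \<Sum>l\<in>J. X d j l)) \<partial>?D)"
    using ptw by (intro nn_integral_mono ennreal_leI)
  also have "\<dots> = (\<integral>\<^sup>+ d. (\<Sum>j\<in>J. \<Sum>s\<in>{1, -1}. ennreal (L d j s * Q d j s))
       + ennreal (\<tau>\<^sup>2 / (2 * m\<^sup>2)) * (\<Sum>j\<in>J. \<Sum>l\<in>J. ennreal (X d j l)) \<partial>?D)"
  proof (rule nn_integral_cong)
    fix d
    have "ennreal (\<Sum>j\<in>J. \<Sum>s\<in>{1, -1}. L d j s * Q d j s) = (\<Sum>j\<in>J. \<Sum>s\<in>{1, -1}. ennreal (L d j s * Q d j s))"
      using pos by (simp add: sum_nonneg flip: ennreal_plus)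
    moreover have "ennreal (\<Sum>j\<in>J. \<Sum>l\<in>J. X d j l) = (\<Sum>j\<in>J. \<Sum>l\<in>J. ennreal (X d j l))"
      using pos by (simp add: sum_nonneg)
    moreover have "0 \<le> (\<Sum>j\<in>J. \<Sum>s\<in>{1, -1}. L d j s * Q d j s)" "0 \<le> (\<Sum>j\<in>J. \<Sum>l\<in>J. X d j l)"
      using pos by (auto intro!: sum_nonneg)
    ultimately show "ennreal ((\<Sum>j\<in>J. \<Sum>s\<in>{1, -1}. L d j s * Q d j s)
         + \<tau>\<^sup>2 / (2 * m\<^sup>2) * (\<Sum>j\<in>J. \<Sum>l\<in>J. X d j l))
       = (\<Sum>j\<in>J. \<Sum>s\<in>{1, -1}. ennreal (L d j s * Q d j s))
         + ennreal (\<tau>\<^sup>2 / (2 * m\<^sup>2)) * (\<Sum>j\<in>J. \<Sum>l\<in>J. ennreal (X d j l))"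
      by (subst ennreal_plus) (simp_all only: ennreal_mult zero_le_divide_iff zero_le_mult_iff zero_le_power2 simp_thms zero_le_numeral)
  qed
  also have "\<dots> = (\<integral>\<^sup>+ d. (\<Sum>j\<in>J. \<Sum>s\<in>{1, -1}. ennreal (L d j s * Q d j s)) \<partial>?D)
       + (\<integral>\<^sup>+ d. ennreal (\<tau>\<^sup>2 / (2 * m\<^sup>2)) * (\<Sum>j\<in>J. \<Sum>l\<in>J. ennreal (X d j l)) \<partial>?D)"
    by (intro nn_integral_add borel_measurable_sum borel_measurable_times) (auto cong: measurable_cong_sets)
  also have "(\<integral>\<^sup>+ d. (\<Sum>j\<in>J. \<Sum>s\<in>{1, -1}. ennreal (L d j s * Q d j s)) \<partial>?D)
      = (\<Sum>j\<in>J. \<Sum>s\<in>{1, -1}. \<integral>\<^sup>+ d. ennreal (L d j s * Q d j s) \<partial>?D)"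
    by (subst nn_integral_sum) (auto intro!: sum.cong nn_integral_sum nn_integral_add cong: measurable_cong_sets)
  also have "(\<integral>\<^sup>+ d. ennreal (\<tau>\<^sup>2 / (2 * m\<^sup>2)) * (\<Sum>j\<in>J. \<Sum>l\<in>J. ennreal (X d j l)) \<partial>?D)
      = ennreal (\<tau>\<^sup>2 / (2 * m\<^sup>2)) * (\<integral>\<^sup>+ d. (\<Sum>j\<in>J. \<Sum>l\<in>J. ennreal (X d j l)) \<partial>?D)"
    by (intro nn_integral_cmult borel_measurable_sum) (auto cong: measurable_cong_sets)
  also have "(\<integral>\<^sup>+ d. (\<Sum>j\<in>J. \<Sum>l\<in>J. ennreal (X d j l)) \<partial>?D) = (\<Sum>j\<in>J. \<Sum>l\<in>J. \<integral>\<^sup>+ d. ennreal (X d j l) \<partial>?D)"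
    by (subst nn_integral_sum) (auto intro!: sum.cong nn_integral_sum nn_integral_add cong: measurable_cong_sets)
  also have "(\<Sum>j\<in>J. \<Sum>s\<in>{1, -1}. \<integral>\<^sup>+ d. ennreal (L d j s * Q d j s) \<partial>?D)
    = (\<Sum>j\<in>J. \<Sum>s\<in>{1, -1}. \<integral>\<^sup>+ d. ennreal (\<Sum>i\<in>J. (h d i - (\<beta>(j := s * \<tau>)) i)\<^sup>2)
        \<partial>data_dist n p \<sigma> (\<beta>(j := s * \<tau>)))" (is "_ = ?R")
    by (intro sum.cong refl) (rule ri[symmetric])
  also have "?R + ennreal (\<tau>\<^sup>2 / (2 * m\<^sup>2)) * (\<Sum>j\<in>J. \<Sum>l\<in>J. \<integral>\<^sup>+ d. ennreal (X d j l) \<partial>?D)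
      \<le> ?R + ennreal (\<tau>\<^sup>2 * V)"
  proof (rule add_left_mono)
    \<comment> \<open>The number \<open>m\<^sup>2\<close> of pairs cancels against the
      \<open>m\<^sup>2\<close> in \<open>B\<close>, so the sum over all \<open>2 * m\<close> spikes
      loses only \<open>\<tau>\<^sup>2 * V\<close>, without a factor \<open>m\<close>.\<close>
    have "(\<Sum>j\<in>J. \<Sum>l\<in>J. \<integral>\<^sup>+ d. ennreal (X d j l) \<partial>?D) \<le> (\<Sum>j\<in>J. \<Sum>l\<in>J. ennreal (2 * V))"
      using XV by (intro sum_mono)
    also have "\<dots> = ennreal (2 * m\<^sup>2 * V)"
      using V0 by (simp add: m_def power2_eq_square ennreal_of_nat_eq_real_of_nat mult_ac flip: ennreal_mult)
    finally have "ennreal (\<tau>\<^sup>2 / (2 * m\<^sup>2)) * (\<Sum>j\<in>J. \<Sum>l\<in>J. \<integral>\<^sup>+ d. ennreal (X d j l) \<partial>?D)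
        \<le> ennreal (\<tau>\<^sup>2 / (2 * m\<^sup>2)) * ennreal (2 * m\<^sup>2 * V)"
      by (intro mult_left_mono) simp_all
    also have "\<dots> = ennreal (\<tau>\<^sup>2 * V)"
      using m V0 by (simp flip: ennreal_mult)
    finally show "ennreal (\<tau>\<^sup>2 / (2 * m\<^sup>2)) * (\<Sum>j\<in>J. \<Sum>l\<in>J. \<integral>\<^sup>+ d. ennreal (X d j l) \<partial>?D)
        \<le> ennreal (\<tau>\<^sup>2 * V)" .
  qed
  finally show ?thesis unfolding m_def V_def .
qed

text \<open>The swap of \<open>(f, s)\<close> with \<open>(f(b := s), f b)\<close> is an involution:
  under a uniform prior, redrawing one block leaves the prior unchanged.\<close>

lemma sum_PiE_resample:
  fixes g :: "('a \<Rightarrow> 'b) \<Rightarrow> ennreal"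
  assumes I: "finite I" and S: "finite S" and b: "b \<in> I"
  shows "(\<Sum>f\<in>I \<rightarrow>\<^sub>E S. \<Sum>s\<in>S. g (f(b := s))) = of_nat (card S) * (\<Sum>f\<in>I \<rightarrow>\<^sub>E S. g f)"
proof -
  have upd: "f(b := s) \<in> I \<rightarrow>\<^sub>E S" if "f \<in> I \<rightarrow>\<^sub>E S" "s \<in> S" for f s
    using that b by (auto simp: PiE_iff extensional_def)
  have "(\<Sum>f\<in>I \<rightarrow>\<^sub>E S. \<Sum>s\<in>S. g (f(b := s))) = (\<Sum>(f, s)\<in>(I \<rightarrow>\<^sub>E S) \<times> S. g (f(b := s)))"
    using I S by (simp add: sum.cartesian_product)
  also have "\<dots> = (\<Sum>(f, s)\<in>(I \<rightarrow>\<^sub>E S) \<times> S. g f)"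
    by (rule sum.reindex_bij_witness[where i = "\<lambda>(f, s). (f(b := s), f b)" and j = "\<lambda>(f, s). (f(b := s), f b)"])
       (use b upd in auto)
  also have "\<dots> = (\<Sum>f\<in>I \<rightarrow>\<^sub>E S. \<Sum>s\<in>S. g f)"
    by (rule sum.cartesian_product[symmetric])
  also have "\<dots> = of_nat (card S) * (\<Sum>f\<in>I \<rightarrow>\<^sub>E S. g f)"
    by (simp add: sum_distrib_left)
  finally show ?thesis .
qed

section \<open>Minimax lower bound\<close>

text \<open>\<open>f b = (l, s)\<close> puts a spike of sign \<open>s\<close> at offset
  \<open>l\<close> of block \<open>b\<close>, that is at \<open>b * m + l\<close>; quotient and
  remainder by \<open>m\<close> recover block and offset. Coordinates from \<open>k * m\<close> on
  are 0.\<close>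

definition spikes :: "nat \<Rightarrow> nat \<Rightarrow> nat \<Rightarrow> real \<Rightarrow> (nat \<Rightarrow> nat \<times> real) \<Rightarrow> nat \<Rightarrow> real" where
  "spikes p k m \<tau> f = (\<lambda>j\<in>{..<p}. if j < k * m \<and> j mod m = fst (f (j div m))
     then snd (f (j div m)) * \<tau> else 0)"

abbreviation spike_choices :: "nat \<Rightarrow> (nat \<times> real) set" where
  "spike_choices m \<equiv> {..<m} \<times> {1, -1}"

lemma spikes_in_Theta:
  assumes m: "m > 0" and f: "f \<in> {..<k} \<rightarrow>\<^sub>E spike_choices m"
  shows "spikes p k m \<tau> f \<in> Theta p k \<tau>"
proof -
  \<comment> \<open>The spike positions, one per block: both the sparsity and the energy are bounded
    through the cardinality of \<open>T\<close>.\<close>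
  define T where "T = (\<lambda>b. b * m + fst (f b)) ` {..<k}"
  have T: "finite T" "card T \<le> k"
    unfolding T_def using card_image_le[of "{..<k}" "\<lambda>b. b * m + fst (f b)"] by auto
  have inT: "j \<in> T" if "j < k * m" "j mod m = fst (f (j div m))" for j
  proof -
    have "j div m < k" using that m by (simp add: less_mult_imp_div_less)
    moreover have "j = (j div m) * m + fst (f (j div m))" using that(2) by (metis div_mult_mod_eq)
    ultimately show ?thesis unfolding T_def by blast
  qed
  have sgn: "(snd (f b))\<^sup>2 = 1" if "b < k" for b
  proof -
    have "f b \<in> spike_choices m" using PiE_mem[OF f, of b] that by simp
    then show ?thesis by (auto simp: mem_Times_iff)
  qed
  have "{j \<in> {..<p}. spikes p k m \<tau> f j \<noteq> 0} \<subseteq> T"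
    using inT by (auto simp: spikes_def split: if_splits)
  then have l0: "l0norm p (spikes p k m \<tau> f) \<le> k"
    unfolding l0norm_def using card_mono[OF T(1)] T(2) by (meson order_trans)
  have "(spikes p k m \<tau> f j)\<^sup>2 \<le> (if j \<in> T then \<tau>\<^sup>2 else 0)" if "j < p" for j
    using inT[of j] sgn[of "j div m"] that m
    by (auto simp: spikes_def power_mult_distrib less_mult_imp_div_less)
  then have "sqnorm p (spikes p k m \<tau> f) \<le> (\<Sum>j<p. if j \<in> T then \<tau>\<^sup>2 else 0)"
    unfolding sqnorm_def by (intro sum_mono) simp
  also have "\<dots> = real (card ({..<p} \<inter> T)) * \<tau>\<^sup>2"
    by (simp add: sum.If_cases)
  also have "\<dots> \<le> real k * \<tau>\<^sup>2"
    using card_mono[OF T(1), of "{..<p} \<inter> T"] T(2) by (intro mult_right_mono) auto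
  finally show ?thesis
    using l0 by (simp add: Theta_def spikes_def)
qed

text \<open>Redrawing block \<open>b\<close> means clearing it and writing a single spike, which is
  the form that the one-block Bayes bound expects.\<close>

lemma spikes_update:
  assumes m: "m > 0" and km: "k * m \<le> p" and b: "b < k" and l: "l < m"
  shows "spikes p k m \<tau> (f(b := (l, s)))
    = (\<lambda>j. if j \<in> {b * m..<b * m + m} then 0 else spikes p k m \<tau> f j)(b * m + l := s * \<tau>)"
proof
  fix j
  have block: "j \<in> {b * m..<b * m + m} \<longleftrightarrow> j div m = b"
    using m by (auto simp: div_nat_eqI dividend_less_times_div mult.commute)
      (metis dividend_less_div_times div_times_less_eq_dividend add.commute mult.commute)+
  show "spikes p k m \<tau> (f(b := (l, s))) j
    = ((\<lambda>j. if j \<in> {b * m..<b * m + m} then 0 else spikes p k m \<tau> f j)(b * m + l := s * \<tau>)) j"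
  proof (cases "j div m = b")
    case True
    have "Suc b * m \<le> k * m" using b by (intro mult_le_mono1) simp
    then have lt: "j < k * m" "j < p" using True block km by auto
    have "j mod m = l \<longleftrightarrow> j = b * m + l"
      using True l by (metis add.commute div_mult_mod_eq mod_less mod_mult_self1)
    moreover have "j \<in> {b * m..<b * m + m}" using True block by simp
    ultimately show ?thesis using True lt by (auto simp: spikes_def)
  next
    case False
    then have "j \<noteq> b * m + l" using l by auto
    moreover have "j \<notin> {b * m..<b * m + m}" using False block by simp
    ultimately show ?thesis using False by (auto simp: spikes_def)
  qed
qed

text \<open>The worst case dominates the average over all \<open>f\<close>. The block bound applies
  to redrawn configurations, resampling turns these back into a sum over \<open>f\<close>, and the
  losses of disjoint blocks add up to at most the risk. All averages are kept as unnormalised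
  sums.\<close>

lemma minimax_risk_ge:
  fixes \<tau> \<sigma> :: real
  assumes n: "n > 0" and k: "1 \<le> k" "k \<le> p" and s: "\<sigma> > 0" and m: "m = p div k"
    and r: "r = (\<tau> / \<sigma>)\<^sup>2" "3 * r < 1"
  shows "ennreal (real k * \<tau>\<^sup>2 * (1 - (1 / sqrt (1 - 3 * r) - 1 + r / 2) / (2 * real m)))
    \<le> minimax_risk n p k \<tau> \<sigma>"
  unfolding minimax_risk_def
proof (rule INF_greatest)
  fix h assume h: "h \<in> estimators n p"
  define W where "W = worst_case_risk n p k \<tau> \<sigma> h"
  define V where "V = 1 / sqrt (1 - 3 * r) - 1 + r / 2"
  have r0: "r \<ge> 0" by (simp add: r(1))
  have V0: "V \<ge> 0" using r0 r(2) by (simp add: V_def)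
  have m0: "m > 0" unfolding m using k by (simp add: div_greater_zero_iff)
  have km: "k * m \<le> p" unfolding m by simp
  let ?F = "{..<k} \<rightarrow>\<^sub>E spike_choices m"
  let ?J = "\<lambda>b. {b * m..<b * m + m}"
  have finF: "finite ?F" by (intro finite_PiE) auto
  define N where "N = real (card ?F)"
  have N0: "N > 0"
    using finF m0 by (auto simp: N_def card_gt_0_iff PiE_eq_empty_iff)
  have cardS: "card (spike_choices m) = 2 * m"
    by (simp add: card_cartesian_product)
  define X where "X b f = (\<integral>\<^sup>+ d. ennreal (\<Sum>i\<in>?J b. (h d i - spikes p k m \<tau> f i)\<^sup>2) \<partial>data_dist n p \<sigma> (spikes p k m \<tau> f))"
    for b f
  \<comment> \<open>Only block \<open>b\<close> is redrawn; what \<open>f\<close> prescribes for the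
    other blocks goes into the base vector.\<close>
  have block: "ennreal (2 * real m * \<tau>\<^sup>2) \<le> (\<Sum>s\<in>spike_choices m. X b (f(b := s))) + ennreal (\<tau>\<^sup>2 * V)"
    if b: "b < k" for b f
  proof -
    define \<beta> where "\<beta> = (\<lambda>j. if j \<in> ?J b then 0 else spikes p k m \<tau> f j)"
    define Y where "Y \<beta>' = (\<integral>\<^sup>+ d. ennreal (\<Sum>i\<in>?J b. (h d i - \<beta>' i)\<^sup>2) \<partial>data_dist n p \<sigma> \<beta>')" for \<beta>'
    have "Suc b * m \<le> k * m" using b by (intro mult_le_mono1) simp
    then have J: "?J b \<subseteq> {..<p}" "?J b \<noteq> {}" using km m0 by auto
    have "(\<Sum>s\<in>spike_choices m. X b (f(b := s))) = (\<Sum>l<m. \<Sum>s\<in>{1, -1}. X b (f(b := (l, s))))"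
      unfolding sum.cartesian_product by (intro sum.cong) auto
    also have "\<dots> = (\<Sum>l<m. \<Sum>s\<in>{1, -1}. Y (\<beta>(b * m + l := s * \<tau>)))"
    proof (intro sum.cong refl)
      fix l and s :: real assume "l \<in> {..<m}"
      then have "spikes p k m \<tau> (f(b := (l, s))) = \<beta>(b * m + l := s * \<tau>)"
        unfolding \<beta>_def using m0 km b by (intro spikes_update) auto
      then show "X b (f(b := (l, s))) = Y (\<beta>(b * m + l := s * \<tau>))"
        by (simp only: X_def Y_def)
    qed
    also have "\<dots> = (\<Sum>j\<in>?J b. \<Sum>s\<in>{1, -1}. Y (\<beta>(j := s * \<tau>)))"
      by (rule sum.reindex_bij_witness[where i = "\<lambda>j. j - b * m" and j = "\<lambda>l. b * m + l"]) auto
    finally show ?thesis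
      using spike_block_bayes_risk[OF n s J, of \<beta> h "\<tau> / \<sigma>"] h r s
      by (simp only: V_def Y_def) (simp add: \<beta>_def)
  qed
  have split: "(\<Sum>b<k. X b f) \<le> W" if f: "f \<in> ?F" for f
  proof -
    let ?b = "spikes p k m \<tau> f"
    have [measurable]: "(\<lambda>d. h d j) \<in> borel_measurable (data_space n p)" if "j < p" for j
      using measurable_compose[OF _ measurable_component_singleton, of h "data_space n p" "{..<p}" "\<lambda>_. borel" j] h that
      by (auto simp: estimators_def)
    have Jp: "i < p" if "b < k" "i \<in> ?J b" for b i
    proof -
      have "Suc b * m \<le> k * m" using that by (intro mult_le_mono1) simp
      then show ?thesis using that km by auto
    qed
    have "(\<Sum>b<k. X b f) = (\<integral>\<^sup>+ d. (\<Sum>b<k. ennreal (\<Sum>i\<in>?J b. (h d i - ?b i)\<^sup>2)) \<partial>data_dist n p \<sigma> ?b)"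
      unfolding X_def using Jp
      by (intro nn_integral_sum[symmetric]) (auto cong: measurable_cong_sets)
    also have "\<dots> \<le> (\<integral>\<^sup>+ d. ennreal (sqnorm p (\<lambda>j. h d j - ?b j)) \<partial>data_dist n p \<sigma> ?b)"
    proof (rule nn_integral_mono)
      fix d
      have "(\<Sum>b<k. \<Sum>i\<in>?J b. (h d i - ?b i)\<^sup>2) = (\<Sum>i<k * m. (h d i - ?b i)\<^sup>2)"
        by (rule sum.nat_group)
      also have "\<dots> \<le> sqnorm p (\<lambda>j. h d j - ?b j)"
        unfolding sqnorm_def using km by (intro sum_mono2) auto
      finally show "(\<Sum>b<k. ennreal (\<Sum>i\<in>?J b. (h d i - ?b i)\<^sup>2)) \<le> ennreal (sqnorm p (\<lambda>j. h d j - ?b j))"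
        by (simp add: sum_nonneg ennreal_leI)
    qed
    also have "\<dots> = risk n p \<sigma> h ?b" by (simp add: risk_def)
    also have "\<dots> \<le> W"
      unfolding W_def worst_case_risk_def using spikes_in_Theta[OF m0 f] by (rule SUP_upper)
    finally show ?thesis .
  qed
  have "of_nat (card ?F) * (of_nat k * ennreal (2 * real m * \<tau>\<^sup>2)) = (\<Sum>f\<in>?F. \<Sum>b<k. ennreal (2 * real m * \<tau>\<^sup>2))"
    by simp
  also have "\<dots> \<le> (\<Sum>f\<in>?F. \<Sum>b<k. (\<Sum>s\<in>spike_choices m. X b (f(b := s))) + ennreal (\<tau>\<^sup>2 * V))"
    using block by (intro sum_mono) auto
  also have "\<dots> = (\<Sum>b<k. \<Sum>f\<in>?F. \<Sum>s\<in>spike_choices m. X b (f(b := s))) + of_nat (card ?F) * (of_nat k * ennreal (\<tau>\<^sup>2 * V))"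
    by (subst sum.swap) (simp add: sum.distrib mult_ac)
  \<comment> \<open>Every configuration is produced by \<open>2 * m\<close> redraws of block
    \<open>b\<close>; this factor becomes the denominator \<open>2 * m\<close> of the claim.\<close>
  also have "(\<Sum>b<k. \<Sum>f\<in>?F. \<Sum>s\<in>spike_choices m. X b (f(b := s))) = (\<Sum>b<k. of_nat (2 * m) * (\<Sum>f\<in>?F. X b f))"
    unfolding cardS[symmetric] by (intro sum.cong refl sum_PiE_resample) auto
  also have "\<dots> = of_nat (2 * m) * (\<Sum>f\<in>?F. \<Sum>b<k. X b f)"
    by (subst sum.swap) (simp add: sum_distrib_left)
  also have "of_nat (2 * m) * (\<Sum>f\<in>?F. \<Sum>b<k. X b f) + of_nat (card ?F) * (of_nat k * ennreal (\<tau>\<^sup>2 * V))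
     \<le> of_nat (2 * m) * (\<Sum>f\<in>?F. W) + of_nat (card ?F) * (of_nat k * ennreal (\<tau>\<^sup>2 * V))"
    using split by (intro add_right_mono mult_left_mono sum_mono) auto
  finally have main: "of_nat (card ?F) * (of_nat k * ennreal (2 * real m * \<tau>\<^sup>2))
     \<le> of_nat (2 * m) * (of_nat (card ?F) * W) + of_nat (card ?F) * (of_nat k * ennreal (\<tau>\<^sup>2 * V))"
    by simp
  show "ennreal (real k * \<tau>\<^sup>2 * (1 - (1 / sqrt (1 - 3 * r) - 1 + r / 2) / (2 * real m))) \<le> worst_case_risk n p k \<tau> \<sigma> h"
    unfolding V_def[symmetric] W_def[symmetric]
  \<comment> \<open>An infinite worst case is trivial; for a finite one the number \<open>N\<close>
    of configurations cancels in the reals.\<close>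
  proof (cases W rule: ennreal_cases)
    case (real w)
    have "ennreal (N * (real k * (2 * real m * \<tau>\<^sup>2))) \<le> ennreal (2 * real m * (N * w) + N * (real k * (\<tau>\<^sup>2 * V)))"
      using main real V0 unfolding N_def
      by (simp add: ennreal_of_nat_eq_real_of_nat ennreal_mult[symmetric] ennreal_plus[symmetric] del: ennreal_plus)
    then have "N * (real k * (2 * real m * \<tau>\<^sup>2)) \<le> 2 * real m * (N * w) + N * (real k * (\<tau>\<^sup>2 * V))"
      using real N0 V0 by (subst (asm) ennreal_le_iff) auto
    then have "N * (real k * (2 * real m * \<tau>\<^sup>2)) \<le> N * (2 * real m * w + real k * (\<tau>\<^sup>2 * V))"
      by (simp add: algebra_simps)
    then have "real k * (2 * real m * \<tau>\<^sup>2) \<le> 2 * real m * w + real k * (\<tau>\<^sup>2 * V)"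
      using N0 by simp
    then have "real k * \<tau>\<^sup>2 * (1 - V / (2 * real m)) \<le> w"
      using m0 by (simp add: field_simps)
    then show "ennreal (real k * \<tau>\<^sup>2 * (1 - V / (2 * real m))) \<le> W"
      unfolding real by (rule ennreal_leI)
  qed simp
qed

section \<open>Passage to the limit\<close>

lemma second_order_expansion:
  fixes R :: "nat \<Rightarrow> ennreal" and M \<delta> u v :: "nat \<Rightarrow> real"
  assumes M: "\<And>n. n \<ge> 1 \<Longrightarrow> M n > 0" and d: "\<And>n. n \<ge> 1 \<Longrightarrow> \<delta> n > 0"
    and nonneg: "\<And>n. n \<ge> 1 \<Longrightarrow> 0 \<le> 1 - \<delta> n + \<delta> n * u n"
    and upper: "\<And>n. n \<ge> 1 \<Longrightarrow> R n \<le> ennreal (M n * (1 - \<delta> n + \<delta> n * u n))"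
    and lower: "eventually (\<lambda>n. ennreal (M n * (1 - \<delta> n * v n)) \<le> R n) sequentially"
    and u: "u \<longlonglongrightarrow> 0" and v: "v \<longlonglongrightarrow> 1"
  shows "\<exists>\<epsilon>. \<epsilon> \<longlonglongrightarrow> 0 \<and> (\<forall>n\<ge>1. enn2ereal (R n) = ereal (M n * (1 - \<delta> n * (1 + \<epsilon> n))))"
proof -
  define r where "r n = enn2real (R n)" for n
  \<comment> \<open>\<open>\<epsilon>\<close> solves the claimed identity, so only its limit is at
    stake; it is squeezed between \<open>- u\<close> and \<open>v - 1\<close>.\<close>
  define \<epsilon> where "\<epsilon> n = (1 - r n / M n) / \<delta> n - 1" for n
  \<comment> \<open>Finiteness comes from the upper bound, which is why that bound is required for
    every \<open>n \<ge> 1\<close> and the lower one only eventually.\<close>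
  have R: "R n = ennreal (r n)" "r n \<ge> 0" if "n \<ge> 1" for n
    using upper[OF that] by (auto simp: r_def top.extremum_unique intro!: ennreal_enn2real[symmetric] le_neq_trans)
  have "enn2ereal (R n) = ereal (M n * (1 - \<delta> n * (1 + \<epsilon> n)))" if n: "n \<ge> 1" for n
  proof -
    have "M n * (1 - \<delta> n * (1 + \<epsilon> n)) = r n"
      using M[OF n] d[OF n] by (simp add: \<epsilon>_def field_simps)
    then show ?thesis using R[OF n] by (simp add: enn2ereal_ennreal)
  qed
  moreover have "\<epsilon> \<longlonglongrightarrow> 0"
  proof (rule tendsto_sandwich)
    show "eventually (\<lambda>n. - u n \<le> \<epsilon> n) sequentially"
      using eventually_ge_at_top[of 1]
    proof eventually_elim
      case (elim n)
      \<comment> \<open>\<open>ennreal\<close> sends negative reals to 0, so the return to the reals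
        needs the nonnegativity hypothesis.\<close>
      have "r n \<le> M n * (1 - \<delta> n + \<delta> n * u n)"
        using upper[OF elim] R[OF elim] nonneg[OF elim] M[OF elim] by simp
      then have "r n / M n \<le> 1 - \<delta> n + \<delta> n * u n"
        using M[OF elim] by (simp add: divide_le_eq mult.commute)
      then have "\<delta> n * (1 - u n) \<le> 1 - r n / M n" by (simp add: algebra_simps)
      then have "1 - u n \<le> (1 - r n / M n) / \<delta> n"
        using d[OF elim] by (simp add: le_divide_eq mult.commute)
      then show ?case by (simp add: \<epsilon>_def)
    qed
    show "eventually (\<lambda>n. \<epsilon> n \<le> v n - 1) sequentially"
      using lower eventually_ge_at_top[of 1]
    proof eventually_elim
      case (elim n)
      have "M n * (1 - \<delta> n * v n) \<le> r n"
        using elim R[OF elim(2)] by (cases "0 \<le> M n * (1 - \<delta> n * v n)") (auto simp: ennreal_le_iff)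
      then have "1 - \<delta> n * v n \<le> r n / M n"
        using M[OF elim(2)] by (simp add: le_divide_eq mult.commute)
      then have "1 - r n / M n \<le> \<delta> n * v n" by linarith
      then have "(1 - r n / M n) / \<delta> n \<le> v n"
        using d[OF elim(2)] by (simp add: divide_le_eq mult.commute)
      then show ?case by (simp add: \<epsilon>_def)
    qed
    show "(\<lambda>n. - u n) \<longlonglongrightarrow> 0" using tendsto_minus[OF u] by simp
    show "(\<lambda>n. v n - 1) \<longlonglongrightarrow> 0" using tendsto_diff[OF v tendsto_const[of 1]] by simp
  qed
  ultimately show ?thesis by blast
qed

text \<open>In the ridge claim one \<open>\<epsilon>\<close> has to serve all measurable selections;
  they agree on every data set because the normal equations have a unique solution.\<close>

lemma worst_case_risk_ridge_unique:
  assumes "l > 0" "h \<in> ridge_estimators n p l" "h' \<in> ridge_estimators n p l"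
  shows "worst_case_risk n p k \<tau> \<sigma> h = worst_case_risk n p k \<tau> \<sigma> h'"
proof -
  have "risk n p \<sigma> h \<beta> = risk n p \<sigma> h' \<beta>" for \<beta>
    unfolding risk_def
  proof (rule nn_integral_cong)
    fix d assume "d \<in> space (data_dist n p \<sigma> \<beta>)"
    then have "d \<in> space (data_space n p)" using sets_eq_imp_space_eq[OF sets_data_dist] by blast
    then show "ennreal (sqnorm p (\<lambda>j. h d j - \<beta> j)) = ennreal (sqnorm p (\<lambda>j. h' d j - \<beta> j))"
      using ridge_estimators_unique[OF assms] by (auto intro!: arg_cong[where f = ennreal] sqnorm_cong)
  qed
  then show ?thesis by (simp add: worst_case_risk_def)
qed

text \<open>With \<open>s = sqrt (1 - 3 * r)\<close>, the factor \<open>1 - s\<close> of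
  \<open>1 / s - 1\<close> cancels against \<open>3 * r = (1 - s) * (1 + s)\<close>. The limit is
  \<open>3/4 + 1/4\<close>, so the crude exponential bounds still produce the sharp
  constant.\<close>

lemma spike_constant_tendsto:
  fixes r :: "nat \<Rightarrow> real"
  assumes r: "r \<longlonglongrightarrow> 0" and pos: "eventually (\<lambda>n. r n > 0) sequentially"
  shows "(\<lambda>n. (1 / sqrt (1 - 3 * r n) - 1 + r n / 2) / (2 * r n)) \<longlonglongrightarrow> 1"
proof -
  have "(\<lambda>n. 3 / (2 * (sqrt (1 - 3 * r n) * (1 + sqrt (1 - 3 * r n)))) + 1 / 4)
      \<longlonglongrightarrow> 3 / (2 * (sqrt (1 - 3 * 0) * (1 + sqrt (1 - 3 * 0)))) + 1 / 4"
    by (intro tendsto_intros r) auto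
  then have lim: "(\<lambda>n. 3 / (2 * (sqrt (1 - 3 * r n) * (1 + sqrt (1 - 3 * r n)))) + 1 / 4) \<longlonglongrightarrow> 1"
    by simp
  have "eventually (\<lambda>n. r n < 1 / 3) sequentially"
    using order_tendstoD(2)[OF r, of "1/3"] by simp
  with pos have "eventually (\<lambda>n. 3 / (2 * (sqrt (1 - 3 * r n) * (1 + sqrt (1 - 3 * r n)))) + 1 / 4
      = (1 / sqrt (1 - 3 * r n) - 1 + r n / 2) / (2 * r n)) sequentially"
  proof eventually_elim
    case (elim n)
    define s where "s = sqrt (1 - 3 * r n)"
    have s: "s > 0" using elim by (simp add: s_def)
    have "s\<^sup>2 = 1 - 3 * r n" using elim by (simp add: s_def)
    then have rs: "r n = (1 - s) * (1 + s) / 3" by (simp add: power2_eq_square algebra_simps)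
    have s1: "1 - s \<noteq> 0" using elim rs by auto
    have "(1 / s - 1) / (2 * r n) = 3 / (2 * (s * (1 + s)))"
    proof -
      have "1 / s - 1 = (1 - s) / s" using s by (simp add: diff_divide_distrib)
      moreover have "e / s / (2 * (e * q / 3)) = 3 / (2 * (s * q))" if "e \<noteq> 0" "q > 0" for e q
        using s that by (simp add: field_simps)
      from this[of "1 - s" "1 + s"] have "(1 - s) / s / (2 * ((1 - s) * (1 + s) / 3)) = 3 / (2 * (s * (1 + s)))"
        using s s1 by linarith
      ultimately show ?thesis unfolding rs by (simp only:)
    qed
    moreover have "(r n / 2) / (2 * r n) = 1 / 4" using elim by simp
    ultimately have "3 / (2 * (s * (1 + s))) + 1 / 4 = (1 / s - 1) / (2 * r n) + (r n / 2) / (2 * r n)" by simp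
    then show ?case unfolding s_def[symmetric] by (simp only: add_divide_distrib)
  qed
  with lim show ?thesis by (rule Lim_transform_eventually)
qed

text \<open>Rounding in \<open>p div k\<close> leaves fewer than \<open>k\<close> coordinates
  outside the blocks, a vanishing fraction of \<open>p\<close>.\<close>

lemma block_count_tendsto:
  fixes p k :: "nat \<Rightarrow> nat"
  assumes k: "\<And>n. n \<ge> 1 \<Longrightarrow> 1 \<le> k n \<and> k n \<le> p n" and kp: "(\<lambda>n. real (k n) / real (p n)) \<longlonglongrightarrow> 0"
  shows "(\<lambda>n. real (p n) / (real (k n) * real (p n div k n))) \<longlonglongrightarrow> 1"
proof -
  have "(\<lambda>n. real (k n) * real (p n div k n) / real (p n)) \<longlonglongrightarrow> 1"
  proof (rule tendsto_sandwich)
    show "eventually (\<lambda>n. 1 - real (k n) / real (p n) \<le> real (k n) * real (p n div k n) / real (p n)) sequentially"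
      using eventually_ge_at_top[of 1]
    proof eventually_elim
      case (elim n)
      have "p n mod k n < k n" using k[OF elim] by simp
      then have "real (p n) \<le> real (k n * (p n div k n) + k n)"
        unfolding of_nat_le_iff using mult_div_mod_eq[of "k n" "p n"] by linarith
      then have "(real (p n) - real (k n)) / real (p n) \<le> real (k n) * real (p n div k n) / real (p n)"
        by (intro divide_right_mono) simp_all
      then show ?case using k[OF elim] by (simp add: diff_divide_distrib)
    qed
    show "eventually (\<lambda>n. real (k n) * real (p n div k n) / real (p n) \<le> 1) sequentially"
      using eventually_ge_at_top[of 1]
    proof eventually_elim
      case (elim n)
      have "real (k n * (p n div k n)) \<le> real (p n)"
        unfolding of_nat_le_iff by simp
      then show ?case using k[OF elim] by (simp add: divide_le_eq)
    qed
    show "(\<lambda>n. 1 - real (k n) / real (p n)) \<longlonglongrightarrow> 1"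
      using tendsto_diff[OF tendsto_const[of 1] kp] by simp
  qed simp
  from tendsto_inverse[OF this] show ?thesis by (simp add: inverse_eq_divide)
qed

theorem theorem3:
  fixes p k :: "nat \<Rightarrow> nat" and \<sigma> \<tau> :: "nat \<Rightarrow> real"
  assumes k_range: "\<And>n. n \<ge> 1 \<Longrightarrow> 1 \<le> k n \<and> k n \<le> p n"
    and \<sigma>_pos: "\<And>n. n \<ge> 1 \<Longrightarrow> \<sigma> n > 0"
    and \<tau>_pos: "\<And>n. n \<ge> 1 \<Longrightarrow> \<tau> n > 0"
    and k_p: "(\<lambda>n. real (k n) / real (p n)) \<longlonglongrightarrow> 0"
    and k_n: "(\<lambda>n. real (k n) / real n) \<longlonglongrightarrow> 0"
    and snr: "(\<lambda>n. \<tau> n / \<sigma> n) \<longlonglongrightarrow> 0"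
  shows "(\<exists>\<epsilon> :: nat \<Rightarrow> real. \<epsilon> \<longlonglongrightarrow> 0 \<and>
           (\<forall>n\<ge>1. enn2ereal (minimax_risk n (p n) (k n) (\<tau> n) (\<sigma> n)) =
              ereal (real (k n) * (\<tau> n)\<^sup>2 *
                (1 - real (k n) * (\<tau> n)\<^sup>2 / (real (p n) * (\<sigma> n)\<^sup>2) * (1 + \<epsilon> n)))))
       \<and> (\<exists>\<epsilon> :: nat \<Rightarrow> real. \<epsilon> \<longlonglongrightarrow> 0 \<and>
           (\<forall>n\<ge>1.
              let R = ridge_estimators n (p n) (real (p n) * (\<sigma> n)\<^sup>2 / (real (k n) * (\<tau> n)\<^sup>2))
              in R \<noteq> {} \<and>
                 (\<forall>h\<in>R. enn2ereal (worst_case_risk n (p n) (k n) (\<tau> n) (\<sigma> n) h) =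
                    ereal (real (k n) * (\<tau> n)\<^sup>2 *
                      (1 - real (k n) * (\<tau> n)\<^sup>2 / (real (p n) * (\<sigma> n)\<^sup>2) * (1 + \<epsilon> n))))))"
proof -
  define M where "M n = real (k n) * (\<tau> n)\<^sup>2" for n
  define \<delta> where "\<delta> n = M n / (real (p n) * (\<sigma> n)\<^sup>2)" for n
  define l where "l n = real (p n) * (\<sigma> n)\<^sup>2 / M n" for n
  define r where "r n = (\<tau> n / \<sigma> n)\<^sup>2" for n
  \<comment> \<open>\<open>\<delta> * u\<close> is the second-order error of the ridge bound, and
    \<open>\<delta> * v\<close> the loss \<open>V / (2 * m)\<close> of the lower bound.\<close>
  define u where "u n = (3 + 9 * real (p n) / real n) * \<delta> n" for n
  define v where "v n = (1 / sqrt (1 - 3 * r n) - 1 + r n / 2) / (2 * r n)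
      * (real (p n) / (real (k n) * real (p n div k n)))" for n
  define h0 where "h0 n = (SOME h. h \<in> ridge_estimators n (p n) (l n))" for n
  have M: "M n > 0" and p: "p n > 0" if "n \<ge> 1" for n
    using k_range[OF that] \<tau>_pos[OF that] by (simp_all add: M_def)
  have d: "\<delta> n > 0" and l: "l n > 0" and dl: "\<delta> n = 1 / l n" and rpos: "r n > 0" if "n \<ge> 1" for n
    using M[OF that] p[OF that] \<sigma>_pos[OF that] \<tau>_pos[OF that] by (simp_all add: \<delta>_def l_def r_def)
  have h0: "h0 n \<in> ridge_estimators n (p n) (l n)" if "n \<ge> 1" for n
    unfolding h0_def using ridge_estimators_nonempty[OF l[OF that]] by (simp add: some_in_eq)
  have dr: "\<delta> n = real (k n) / real (p n) * r n" for n
    by (simp add: \<delta>_def M_def r_def power_divide)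

  have r_lim: "r \<longlonglongrightarrow> 0"
    unfolding r_def using tendsto_power[OF snr, of 2] by simp
  have u_lim: "u \<longlonglongrightarrow> 0"
  proof -
    have "(\<lambda>n. 3 * (real (k n) / real (p n) * r n) + 9 * (real (k n) / real n * r n)) \<longlonglongrightarrow> 3 * (0 * 0) + 9 * (0 * 0)"
      by (intro tendsto_intros k_p k_n r_lim)
    then have "(\<lambda>n. 3 * (real (k n) / real (p n) * r n) + 9 * (real (k n) / real n * r n)) \<longlonglongrightarrow> 0" by simp
    moreover have "eventually (\<lambda>n. 3 * (real (k n) / real (p n) * r n) + 9 * (real (k n) / real n * r n) = u n) sequentially"
      using eventually_ge_at_top[of 1]
    proof eventually_elim
      case (elim n)
      then show ?case using p[OF elim] by (simp add: u_def dr field_simps)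
    qed
    ultimately show ?thesis by (rule Lim_transform_eventually)
  qed
  have v_lim: "v \<longlonglongrightarrow> 1"
  proof -
    have "eventually (\<lambda>n. r n > 0) sequentially"
      using eventually_ge_at_top[of 1] by eventually_elim (rule rpos)
    from tendsto_mult[OF spike_constant_tendsto[OF r_lim this] block_count_tendsto[OF k_range k_p]]
    show ?thesis unfolding v_def by simp
  qed

  have nonneg: "0 \<le> 1 - \<delta> n + \<delta> n * u n" if n: "n \<ge> 1" for n
  proof -
    \<comment> \<open>Completing the square covers all \<open>n \<ge> 1\<close>, including those
      where \<open>\<delta> n\<close> is not yet small.\<close>
    have "1 - \<delta> n + \<delta> n * u n = (1 - \<delta> n / 2)\<^sup>2 + (11 / 4 + 9 * real (p n) / real n) * (\<delta> n)\<^sup>2"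
      by (simp add: u_def power2_eq_square algebra_simps)
    also have "\<dots> \<ge> 0" by simp
    finally show ?thesis .
  qed
  have upper: "worst_case_risk n (p n) (k n) (\<tau> n) (\<sigma> n) (h0 n) \<le> ennreal (M n * (1 - \<delta> n + \<delta> n * u n))"
    if n: "n \<ge> 1" for n
  proof -
    have "1 - \<delta> n + \<delta> n * u n = 1 - 1 / l n + (3 + 9 * real (p n) / real n) / (l n)\<^sup>2"
      by (simp add: u_def dl[OF n] power2_eq_square)
    moreover have "worst_case_risk n (p n) (k n) (\<tau> n) (\<sigma> n) (h0 n)
        \<le> ennreal (M n * (1 - 1 / l n + (3 + 9 * real (p n) / real n) / (l n)\<^sup>2))"
      using k_range[OF n] p[OF n] \<sigma>_pos[OF n] \<tau>_pos[OF n] h0[OF n] n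
      by (intro ridge_worst_case_le) (simp_all add: M_def l_def)
    ultimately show ?thesis by (simp only:)
  qed
  have minimax_le: "minimax_risk n (p n) (k n) (\<tau> n) (\<sigma> n) \<le> worst_case_risk n (p n) (k n) (\<tau> n) (\<sigma> n) (h0 n)"
    if "n \<ge> 1" for n
    unfolding minimax_risk_def using h0[OF that] by (intro INF_lower) (simp add: ridge_estimators_def)
  have lower: "eventually (\<lambda>n. ennreal (M n * (1 - \<delta> n * v n)) \<le> minimax_risk n (p n) (k n) (\<tau> n) (\<sigma> n)) sequentially"
    using order_tendstoD(2)[OF r_lim, of "1/3", simplified] eventually_ge_at_top[of 1]
  proof eventually_elim
    case (elim n)
    define V where "V = 1 / sqrt (1 - 3 * r n) - 1 + r n / 2"
    have "\<delta> n * v n = V / (2 * real (p n div k n))"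
      unfolding dr v_def V_def[symmetric] using rpos[OF elim(2)] k_range[OF elim(2)] p[OF elim(2)]
      by (simp add: field_simps)
    then show ?case
      using minimax_risk_ge[of n "k n" "p n" "\<sigma> n" "p n div k n" "r n" "\<tau> n"] elim k_range[OF elim(2)] \<sigma>_pos[OF elim(2)]
      unfolding V_def by (simp add: M_def r_def)
  qed

  have minimax: "\<exists>\<epsilon>. \<epsilon> \<longlonglongrightarrow> 0 \<and> (\<forall>n\<ge>1. enn2ereal (minimax_risk n (p n) (k n) (\<tau> n) (\<sigma> n)) = ereal (M n * (1 - \<delta> n * (1 + \<epsilon> n))))"
    using M d nonneg order_trans[OF minimax_le upper] lower u_lim v_lim
    by (rule second_order_expansion)
  have "\<exists>\<epsilon>. \<epsilon> \<longlonglongrightarrow> 0 \<and> (\<forall>n\<ge>1. enn2ereal (worst_case_risk n (p n) (k n) (\<tau> n) (\<sigma> n) (h0 n)) = ereal (M n * (1 - \<delta> n * (1 + \<epsilon> n))))"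
  proof -
    \<comment> \<open>The ridge estimator is itself a competitor, so the minimax lower bound is also
      a lower bound for its worst case.\<close>
    have "eventually (\<lambda>n. ennreal (M n * (1 - \<delta> n * v n)) \<le> worst_case_risk n (p n) (k n) (\<tau> n) (\<sigma> n) (h0 n)) sequentially"
      using lower eventually_ge_at_top[of 1]
      by eventually_elim (use minimax_le in \<open>blast intro: order_trans\<close>)
    with M d nonneg upper show ?thesis
      using u_lim v_lim by (rule second_order_expansion)
  qed
  moreover have "worst_case_risk n (p n) (k n) (\<tau> n) (\<sigma> n) h = worst_case_risk n (p n) (k n) (\<tau> n) (\<sigma> n) (h0 n)"
    if "n \<ge> 1" "h \<in> ridge_estimators n (p n) (l n)" for n h
    using worst_case_risk_ridge_unique[OF l] h0 that by blast
  ultimately have ridge: "\<exists>\<epsilon>. \<epsilon> \<longlonglongrightarrow> 0 \<and> (\<forall>n\<ge>1. ridge_estimators n (p n) (l n) \<noteq> {} \<and>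
      (\<forall>h\<in>ridge_estimators n (p n) (l n). enn2ereal (worst_case_risk n (p n) (k n) (\<tau> n) (\<sigma> n) h)
        = ereal (M n * (1 - \<delta> n * (1 + \<epsilon> n)))))"
    using ridge_estimators_nonempty[OF l] by metis
  show ?thesis
    using minimax ridge unfolding Let_def M_def[symmetric] \<delta>_def[symmetric] l_def[symmetric] by blast
qed

end
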